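(* Folded integrable systems do not, in general, admit cotangent models near a regular point: there exist a folded symplectic manifold $(M^{2n},\omega)$ with folding hypersurface $Z$, a folded integrable system $F=(f_1,\dots,f_n)$ on it, and a regular point $p\in Z$ of $F$ whose integral manifold $\mathcal{F}_p$ is compact, such that $F$ does not admit a folded cotangent model near $\mathcal{F}_p$.
   Context: A closed 2-form $\omega$ on a $2n$-dimensional manifold $M$ is folded symplectic if $\omega^n$ is transverse to the zero section of $\Lambda^{2n}(T^*M)$, so that $Z=\{\omega^n=0\}$ (the folding hypersurface) is a codimension-one submanifold, and the pullback $i^*\omega$ to $Z$ has maximal rank $2n-2$. A folded function is a smooth $f:M\to\mathbb{R}$ with $df|_Z(v)=0$ for all $v\in\ker\omega|_Z$; such an $f$ has a smooth Hamiltonian vector field $X_f$, $\iota_{X_f}\omega=-df$. A folded integrable system is an $n$-tuple $F=(f_1,\dots,f_n)$ of folded functions such that $X_{f_1},\dots,X_{f_n}$ are linearly independent on a dense subset of $M$ and on a dense subset of $Z$, and $\omega(X_{f_i},X_{f_j})=0$ for all $i,j$. A point is regular if the $X_{f_i}$ are linearly independent at it; $\mathcal{F}_p$ denotes the leaf through $p$ of the foliation integrating $\langle X_{f_1},\dots,X_{f_n}\rangle$. The folded cotangent model is $T^*\mathbb{T}^n\cong\mathbb{T}^n\times\mathbb{R}^n$ with coordinates $(\theta_1,\dots,\theta_n,p_1,\dots,p_n)$, with the twisted folded symplectic form $\omega_{tw,f}=p_1\,d\theta_1\wedge dp_1+\sum_{i=2}^n d\theta_i\wedge dp_i$ and the integrable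 system given by the moment map $(p_1^2,p_2,\dots,p_n)$ of the lifted translation action of $\mathbb{T}^n$. We say $F$ admits a folded cotangent model near the compact integral manifold $\mathcal{F}_p$ if there are a neighborhood $U$ of $\mathcal{F}_p$ and a diffeomorphism from $U$ onto a neighborhood $\mathbb{T}^n\times B^n$ of the zero section of $T^*\mathbb{T}^n$ which sends $\mathcal{F}_p$ to the zero section $\mathbb{T}^n\times\{0\}$, pulls $\omega_{tw,f}$ back to $\omega$, and sends the foliation by integral manifolds of $F$ to the foliation $\{\mathbb{T}^n\times\{b\}\}_{b\in B^n}$. *)

theory Defs
  imports "HOL-Analysis.Analysis"
begin

section \<open>Smooth functions on open subsets of coordinate space\<close>

text \<open>Dimensions are natural numbers, not types: \<open>\<real>\<^sup>m\<close> is the space \<^const>\<open>Euclidean_space\<close>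
  of sequences vanishing from index \<open>m\<close> on, and coordinates are numbered from \<open>0\<close>.\<close>

abbreviation coord_space :: "nat \<Rightarrow> (nat \<Rightarrow> real) set" where
  "coord_space m \<equiv> topspace (Euclidean_space m)"

definition partial :: "nat \<Rightarrow> ((nat \<Rightarrow> real) \<Rightarrow> real) \<Rightarrow> (nat \<Rightarrow> real) \<Rightarrow> real" where
  "partial i f x = deriv (\<lambda>t. f (x(i := t))) (x i)"

primrec C_on :: "nat \<Rightarrow> nat \<Rightarrow> (nat \<Rightarrow> real) set \<Rightarrow> ((nat \<Rightarrow> real) \<Rightarrow> real) \<Rightarrow> bool" where
  "C_on m 0 S f \<longleftrightarrow> continuous_map (subtopology (Euclidean_space m) S) euclideanreal f"
| "C_on m (Suc k) S f \<longleftrightarrow>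
     continuous_map (subtopology (Euclidean_space m) S) euclideanreal f \<and>
     (\<forall>i<m. (\<forall>x\<in>S. (\<lambda>t. f (x(i := t))) differentiable at (x i)) \<and> C_on m k S (partial i f))"

text \<open>Only used for open \<open>S\<close>.\<close>

definition smooth_on :: "nat \<Rightarrow> (nat \<Rightarrow> real) set \<Rightarrow> ((nat \<Rightarrow> real) \<Rightarrow> real) \<Rightarrow> bool" where
  "smooth_on m S f \<longleftrightarrow> (\<forall>k. C_on m k S f)"


section \<open>Smooth manifolds\<close>

text \<open>A chart is a pair of its domain and its coordinate map. The atlas need not be maximal.\<close>

type_synonym 'a chart = "'a set \<times> ('a \<Rightarrow> nat \<Rightarrow> real)"

record 'a manifold =
  mdim :: nat
  mtop :: "'a topology"
  matlas :: "'a chart set"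

abbreviation points :: "'a manifold \<Rightarrow> 'a set" where
  "points M \<equiv> topspace (mtop M)"

definition chart_inv :: "'a chart \<Rightarrow> (nat \<Rightarrow> real) \<Rightarrow> 'a" where
  "chart_inv c = inv_into (fst c) (snd c)"

definition is_chart :: "nat \<Rightarrow> 'a topology \<Rightarrow> 'a chart \<Rightarrow> bool" where
  "is_chart m T c \<longleftrightarrow>
     openin T (fst c) \<and>
     openin (Euclidean_space m) (snd c ` fst c) \<and>
     embedding_map (subtopology T (fst c)) (Euclidean_space m) (snd c)"

definition smooth_manifold :: "'a manifold \<Rightarrow> bool" where
  "smooth_manifold M \<longleftrightarrow>
     Hausdorff_space (mtop M) \<and> second_countable (mtop M) \<and>
     (\<forall>c\<in>matlas M. is_chart (mdim M) (mtop M) c) \<and>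
     \<Union> (fst ` matlas M) = points M \<and>
     (\<forall>c\<in>matlas M. \<forall>d\<in>matlas M. \<forall>i<mdim M.
        smooth_on (mdim M) (snd c ` (fst c \<inter> fst d)) (\<lambda>x. snd d (chart_inv c x) i))"

text \<open>Only used for open \<open>U\<close>.\<close>

definition smooth_map_on :: "'a manifold \<Rightarrow> 'a set \<Rightarrow> 'b manifold \<Rightarrow> ('a \<Rightarrow> 'b) \<Rightarrow> bool" where
  "smooth_map_on M U N f \<longleftrightarrow>
     continuous_map (subtopology (mtop M) U) (mtop N) f \<and>
     (\<forall>c\<in>matlas M. \<forall>d\<in>matlas N. \<forall>i<mdim N.
        smooth_on (mdim M) (snd c ` (fst c \<inter> U \<inter> f -` fst d)) (\<lambda>x. snd d (f (chart_inv c x)) i))"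

definition diffeomorphism_on ::
    "'a manifold \<Rightarrow> 'a set \<Rightarrow> 'b manifold \<Rightarrow> 'b set \<Rightarrow> ('a \<Rightarrow> 'b) \<Rightarrow> bool" where
  "diffeomorphism_on M U N V f \<longleftrightarrow>
     openin (mtop M) U \<and> openin (mtop N) V \<and> bij_betw f U V \<and>
     smooth_map_on M U N f \<and> smooth_map_on N V M (inv_into U f)"

text \<open>The entry \<open>\<partial>y\<^sub>i/\<partial>x\<^sub>j\<close> at \<open>q\<close> of the Jacobian matrix of \<open>f\<close>, for coordinates \<open>x\<close> given by
  \<open>c\<close> around \<open>q\<close> and \<open>y\<close> given by \<open>d\<close> around \<open>f q\<close>. With \<open>f\<close> the identity this is a change of
  coordinates.\<close>

definition jacobian :: "'a chart \<Rightarrow> 'b chart \<Rightarrow> ('a \<Rightarrow> 'b) \<Rightarrow> 'a \<Rightarrow> nat \<Rightarrow> nat \<Rightarrow> real" where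
  "jacobian c d f q i j = partial j (\<lambda>x. snd d (f (chart_inv c x)) i) (snd c q)"

definition smooth_function :: "'a manifold \<Rightarrow> ('a \<Rightarrow> real) \<Rightarrow> bool" where
  "smooth_function M f \<longleftrightarrow>
     (\<forall>c\<in>matlas M. smooth_on (mdim M) (snd c ` fst c) (\<lambda>x. f (chart_inv c x)))"

definition chart_partial :: "'a chart \<Rightarrow> nat \<Rightarrow> ('a \<Rightarrow> real) \<Rightarrow> 'a \<Rightarrow> real" where
  "chart_partial c i f q = partial i (\<lambda>x. f (chart_inv c x)) (snd c q)"

text \<open>\<open>differential m c f q v\<close> is \<open>df\<^sub>q(v)\<close>, for \<open>v\<close> given by its components in the chart \<open>c\<close>.\<close>

definition differential ::
    "nat \<Rightarrow> 'a chart \<Rightarrow> ('a \<Rightarrow> real) \<Rightarrow> 'a \<Rightarrow> (nat \<Rightarrow> real) \<Rightarrow> real" where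
  "differential m c f q v = (\<Sum>i<m. chart_partial c i f q * v i)"


section \<open>Vector fields and 2-forms\<close>

text \<open>Tensor fields are given by their components in the charts of the atlas, subject to the
  transformation law: \<open>X c q i\<close> is the \<open>i\<close>-th component of the vector field \<open>X\<close> at \<open>q\<close> in the
  chart \<open>c\<close>, and \<open>\<omega> c q i j\<close> is \<open>\<omega>\<^sub>q(\<partial>\<^sub>i, \<partial>\<^sub>j)\<close> for the coordinate vectors of \<open>c\<close>.\<close>

type_synonym 'a vector_field = "'a chart \<Rightarrow> 'a \<Rightarrow> nat \<Rightarrow> real"
type_synonym 'a two_form = "'a chart \<Rightarrow> 'a \<Rightarrow> nat \<Rightarrow> nat \<Rightarrow> real"

definition smooth_vector_field :: "'a manifold \<Rightarrow> 'a vector_field \<Rightarrow> bool" where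
  "smooth_vector_field M X \<longleftrightarrow>
     (\<forall>c\<in>matlas M. \<forall>i<mdim M.
        smooth_on (mdim M) (snd c ` fst c) (\<lambda>x. X c (chart_inv c x) i)) \<and>
     (\<forall>c\<in>matlas M. \<forall>d\<in>matlas M. \<forall>q\<in>fst c \<inter> fst d. \<forall>i<mdim M.
        X d q i = (\<Sum>j<mdim M. jacobian c d (\<lambda>x. x) q i j * X c q j))"

definition smooth_two_form :: "'a manifold \<Rightarrow> 'a two_form \<Rightarrow> bool" where
  "smooth_two_form M \<omega> \<longleftrightarrow>
     (\<forall>c\<in>matlas M. \<forall>i<mdim M. \<forall>j<mdim M.
        smooth_on (mdim M) (snd c ` fst c) (\<lambda>x. \<omega> c (chart_inv c x) i j)) \<and>
     (\<forall>c\<in>matlas M. \<forall>q\<in>fst c. \<forall>i<mdim M. \<forall>j<mdim M. \<omega> c q j i = - \<omega> c q i j) \<and>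
     (\<forall>c\<in>matlas M. \<forall>d\<in>matlas M. \<forall>q\<in>fst c \<inter> fst d. \<forall>i<mdim M. \<forall>j<mdim M.
        \<omega> c q i j = (\<Sum>k<mdim M. \<Sum>l<mdim M.
          \<omega> d q k l * jacobian c d (\<lambda>x. x) q k i * jacobian c d (\<lambda>x. x) q l j))"

definition closed_two_form :: "'a manifold \<Rightarrow> 'a two_form \<Rightarrow> bool" where
  "closed_two_form M \<omega> \<longleftrightarrow>
     (\<forall>c\<in>matlas M. \<forall>q\<in>fst c. \<forall>i<mdim M. \<forall>j<mdim M. \<forall>k<mdim M.
        chart_partial c i (\<lambda>r. \<omega> c r j k) q + chart_partial c j (\<lambda>r. \<omega> c r k i) q
        + chart_partial c k (\<lambda>r. \<omega> c r i j) q = 0)"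

definition bilinear_form ::
    "nat \<Rightarrow> (nat \<Rightarrow> nat \<Rightarrow> real) \<Rightarrow> (nat \<Rightarrow> real) \<Rightarrow> (nat \<Rightarrow> real) \<Rightarrow> real" where
  "bilinear_form m B u v = (\<Sum>i<m. \<Sum>j<m. B i j * u i * v j)"

text \<open>The single coefficient \<open>\<beta>\<^sup>n(e\<^sub>1, \<dots>, e\<^sub>2\<^sub>n)\<close> of the \<open>n\<close>-th wedge power of the 2-form with
  matrix \<open>B\<close>, with the convention \<open>(\<alpha> \<and> \<beta>)(u, v) = \<alpha>(u) \<beta>(v) - \<alpha>(v) \<beta>(u)\<close>.\<close>

definition top_power :: "nat \<Rightarrow> (nat \<Rightarrow> nat \<Rightarrow> real) \<Rightarrow> real" where
  "top_power n B =
     (\<Sum>\<sigma> | \<sigma> permutes {..<2*n}. of_int (sign \<sigma>) * (\<Prod>k<n. B (\<sigma> (2*k)) (\<sigma> (2*k+1)))) / 2^n"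

text \<open>The rank of the restriction of a bilinear form to the subspace \<open>W\<close>: the dimension of the
  image of \<open>W \<rightarrow> W\<^sup>*, v \<mapsto> B(v, \<cdot>)\<close>, i.e. the largest number of linearly independent functionals
  in it.\<close>

definition rank_on ::
    "(nat \<Rightarrow> real) set \<Rightarrow> ((nat \<Rightarrow> real) \<Rightarrow> (nat \<Rightarrow> real) \<Rightarrow> real) \<Rightarrow> nat" where
  "rank_on W B =
     (GREATEST k. \<exists>v. (\<forall>i<k. v i \<in> W) \<and>
        (\<forall>a :: nat \<Rightarrow> real. (\<forall>w\<in>W. (\<Sum>i<k. a i * B (v i) w) = 0) \<longrightarrow> (\<forall>i<k. a i = 0)))"


section \<open>Folded symplectic manifolds\<close>

definition folding_hypersurface :: "nat \<Rightarrow> 'a manifold \<Rightarrow> 'a two_form \<Rightarrow> 'a set" where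
  "folding_hypersurface n M \<omega> = {q. \<exists>c\<in>matlas M. q \<in> fst c \<and> top_power n (\<omega> c q) = 0}"

text \<open>In a chart, transversality of \<open>\<omega>\<^sup>n\<close> to the zero section says that the coefficient of
  \<open>\<omega>\<^sup>n\<close> has nonzero differential wherever it vanishes. Its zero set \<open>Z\<close> is then a hypersurface
  whose tangent space is the kernel of that differential.\<close>

definition transverse_top_power :: "nat \<Rightarrow> 'a manifold \<Rightarrow> 'a two_form \<Rightarrow> bool" where
  "transverse_top_power n M \<omega> \<longleftrightarrow>
     (\<forall>c\<in>matlas M. \<forall>q\<in>fst c. top_power n (\<omega> c q) = 0 \<longrightarrow>
        (\<exists>i<mdim M. chart_partial c i (\<lambda>r. top_power n (\<omega> c r)) q \<noteq> 0))"

definition fold_tangent_space ::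
    "nat \<Rightarrow> 'a manifold \<Rightarrow> 'a two_form \<Rightarrow> 'a chart \<Rightarrow> 'a \<Rightarrow> (nat \<Rightarrow> real) set" where
  "fold_tangent_space n M \<omega> c q =
     {v \<in> coord_space (mdim M). differential (mdim M) c (\<lambda>r. top_power n (\<omega> c r)) q v = 0}"

definition folded_symplectic_manifold :: "nat \<Rightarrow> 'a manifold \<Rightarrow> 'a two_form \<Rightarrow> bool" where
  "folded_symplectic_manifold n M \<omega> \<longleftrightarrow>
     smooth_manifold M \<and> mdim M = 2*n \<and>
     smooth_two_form M \<omega> \<and> closed_two_form M \<omega> \<and>
     transverse_top_power n M \<omega> \<and>
     (\<forall>c\<in>matlas M. \<forall>q\<in>fst c \<inter> folding_hypersurface n M \<omega>.
        rank_on (fold_tangent_space n M \<omega> c q) (bilinear_form (2*n) (\<omega> c q)) = 2*n - 2)"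


section \<open>Folded integrable systems\<close>

text \<open>At a point of \<open>Z\<close>, the kernel of \<open>\<omega>\<close> is taken in the whole tangent space of \<open>M\<close>; it is
  two-dimensional.\<close>

definition folded_function :: "nat \<Rightarrow> 'a manifold \<Rightarrow> 'a two_form \<Rightarrow> ('a \<Rightarrow> real) \<Rightarrow> bool" where
  "folded_function n M \<omega> f \<longleftrightarrow>
     smooth_function M f \<and>
     (\<forall>c\<in>matlas M. \<forall>q\<in>fst c \<inter> folding_hypersurface n M \<omega>. \<forall>v\<in>coord_space (mdim M).
        (\<forall>w\<in>coord_space (mdim M). bilinear_form (mdim M) (\<omega> c q) v w = 0) \<longrightarrow>
        differential (mdim M) c f q v = 0)"

definition is_hamiltonian_vector_field ::
    "'a manifold \<Rightarrow> 'a two_form \<Rightarrow> ('a \<Rightarrow> real) \<Rightarrow> 'a vector_field \<Rightarrow> bool" where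
  "is_hamiltonian_vector_field M \<omega> f X \<longleftrightarrow>
     smooth_vector_field M X \<and>
     (\<forall>c\<in>matlas M. \<forall>q\<in>fst c. \<forall>v\<in>coord_space (mdim M).
        bilinear_form (mdim M) (\<omega> c q) (X c q) v = - differential (mdim M) c f q v)"

text \<open>For a folded function on a folded symplectic manifold the field exists, and its components
  in the charts are unique because the complement of \<open>Z\<close> is dense.\<close>

definition hamiltonian_vector_field ::
    "'a manifold \<Rightarrow> 'a two_form \<Rightarrow> ('a \<Rightarrow> real) \<Rightarrow> 'a vector_field" where
  "hamiltonian_vector_field M \<omega> f = (SOME X. is_hamiltonian_vector_field M \<omega> f X)"

definition regular_point ::
    "nat \<Rightarrow> 'a manifold \<Rightarrow> 'a two_form \<Rightarrow> (nat \<Rightarrow> 'a \<Rightarrow> real) \<Rightarrow> 'a \<Rightarrow> bool" where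
  "regular_point n M \<omega> F q \<longleftrightarrow>
     q \<in> points M \<and>
     (\<forall>c\<in>matlas M. q \<in> fst c \<longrightarrow>
        (\<forall>a :: nat \<Rightarrow> real.
           (\<forall>i<mdim M. (\<Sum>k<n. a k * hamiltonian_vector_field M \<omega> (F k) c q i) = 0) \<longrightarrow>
           (\<forall>k<n. a k = 0)))"

definition folded_integrable_system ::
    "nat \<Rightarrow> 'a manifold \<Rightarrow> 'a two_form \<Rightarrow> (nat \<Rightarrow> 'a \<Rightarrow> real) \<Rightarrow> bool" where
  "folded_integrable_system n M \<omega> F \<longleftrightarrow>
     (\<forall>k<n. folded_function n M \<omega> (F k)) \<and>
     points M \<subseteq> mtop M closure_of {q. regular_point n M \<omega> F q} \<and>
     folding_hypersurface n M \<omega>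
       \<subseteq> mtop M closure_of {q \<in> folding_hypersurface n M \<omega>. regular_point n M \<omega> F q} \<and>
     (\<forall>k<n. \<forall>l<n. \<forall>c\<in>matlas M. \<forall>q\<in>fst c.
        bilinear_form (mdim M) (\<omega> c q) (hamiltonian_vector_field M \<omega> (F k) c q)
          (hamiltonian_vector_field M \<omega> (F l) c q) = 0)"

text \<open>A connected integral manifold of \<open>\<langle>X\<^sub>f\<^sub>1, \<dots>, X\<^sub>f\<^sub>n\<rangle>\<close> inside \<open>U\<close>: an injectively immersed
  connected \<open>n\<close>-manifold, possibly with a topology finer than the subspace topology, whose tangent
  spaces are the spans of the Hamiltonian vector fields. As the dimension is \<open>n\<close>, all its points
  are regular.\<close>

definition integral_manifold ::
    "nat \<Rightarrow> 'a manifold \<Rightarrow> 'a two_form \<Rightarrow> (nat \<Rightarrow> 'a \<Rightarrow> real) \<Rightarrow> 'a set \<Rightarrow> 'a manifold \<Rightarrow> bool"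
  where
  "integral_manifold n M \<omega> F U N \<longleftrightarrow>
     smooth_manifold N \<and> mdim N = n \<and> connected_space (mtop N) \<and> points N \<subseteq> U \<and>
     smooth_map_on N (points N) M (\<lambda>x. x) \<and>
     (\<forall>b\<in>matlas N. \<forall>c\<in>matlas M. \<forall>q\<in>fst b \<inter> fst c.
        (\<forall>v\<in>coord_space n.
           (\<forall>i<mdim M. (\<Sum>j<n. jacobian b c (\<lambda>x. x) q i j * v j) = 0) \<longrightarrow> (\<forall>j<n. v j = 0)) \<and>
        {w \<in> coord_space (mdim M). \<exists>v\<in>coord_space n. \<forall>i<mdim M.
           w i = (\<Sum>j<n. jacobian b c (\<lambda>x. x) q i j * v j)} =
        {w \<in> coord_space (mdim M). \<exists>a :: nat \<Rightarrow> real. \<forall>i<mdim M.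
           w i = (\<Sum>k<n. a k * hamiltonian_vector_field M \<omega> (F k) c q i)})"

text \<open>The leaf through \<open>q\<close> of the foliation of the open set \<open>U\<close> by integral manifolds is the
  maximal connected integral manifold in \<open>U\<close> through \<open>q\<close>, i.e. the union of all of them. It is
  empty if \<open>q\<close> is not regular.\<close>

definition leaf ::
    "nat \<Rightarrow> 'a manifold \<Rightarrow> 'a two_form \<Rightarrow> (nat \<Rightarrow> 'a \<Rightarrow> real) \<Rightarrow> 'a set \<Rightarrow> 'a \<Rightarrow> 'a set" where
  "leaf n M \<omega> F U q = \<Union> {points N | N. integral_manifold n M \<omega> F U N \<and> q \<in> points N}"


section \<open>The folded cotangent model\<close>

text \<open>A point \<open>(z, p)\<close> of \<open>T\<^sup>*\<T>\<^sup>n = \<T>\<^sup>n \<times> \<real>\<^sup>n\<close> has \<open>z\<^sub>k = exp(i \<theta>\<^sub>k)\<close>; the entries of \<open>z\<close> of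
  index at least \<open>n\<close> are set to \<open>1\<close>.\<close>

type_synonym cot_point = "(nat \<Rightarrow> complex) \<times> (nat \<Rightarrow> real)"

definition torus :: "nat \<Rightarrow> (nat \<Rightarrow> complex) set" where
  "torus n = {z. (\<forall>k<n. cmod (z k) = 1) \<and> (\<forall>k\<ge>n. z k = 1)}"

definition momentum_ball :: "nat \<Rightarrow> real \<Rightarrow> (nat \<Rightarrow> real) set" where
  "momentum_ball n r = {p \<in> coord_space n. (\<Sum>k<n. (p k)\<^sup>2) < r\<^sup>2}"

text \<open>The charts are all those whose coordinates are \<open>(\<theta>\<^sub>1, \<dots>, \<theta>\<^sub>n, p\<^sub>1, \<dots>, p\<^sub>n)\<close> for some
  continuous branches of the angles \<open>\<theta>\<^sub>k\<close>.\<close>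

definition cotangent_torus :: "nat \<Rightarrow> cot_point manifold" where
  "cotangent_torus n =
     (let T = top_of_set (torus n \<times> coord_space n) in
      \<lparr>mdim = 2*n, mtop = T,
       matlas = {c. is_chart (2*n) T c \<and>
         (\<forall>(z, p)\<in>fst c. \<forall>k<n. cis (snd c (z, p) k) = z k \<and> snd c (z, p) (n + k) = p k)}\<rparr>)"

text \<open>\<open>p\<^sub>1 d\<theta>\<^sub>1 \<and> dp\<^sub>1 + \<Sum>\<^sub>i\<^sub>\<ge>\<^sub>2 d\<theta>\<^sub>i \<and> dp\<^sub>i\<close>, with the same expression in every angle chart.\<close>

definition twisted_form :: "nat \<Rightarrow> cot_point two_form" where
  "twisted_form n c q i j =
     (let w = (\<lambda>k. if k = 0 then snd q 0 else 1) in
      if i < n \<and> j = n + i then w i else if j < n \<and> i = n + j then - w j else 0)"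

definition pullback_eq ::
    "'a manifold \<Rightarrow> 'a set \<Rightarrow> 'b manifold \<Rightarrow> ('a \<Rightarrow> 'b) \<Rightarrow> 'b two_form \<Rightarrow> 'a two_form \<Rightarrow> bool" where
  "pullback_eq M U N f \<eta> \<omega> \<longleftrightarrow>
     (\<forall>c\<in>matlas M. \<forall>d\<in>matlas N. \<forall>q\<in>U \<inter> fst c. f q \<in> fst d \<longrightarrow>
        (\<forall>i<mdim M. \<forall>j<mdim M.
           \<omega> c q i j = (\<Sum>k<mdim N. \<Sum>l<mdim N.
             \<eta> d (f q) k l * jacobian c d f q k i * jacobian c d f q l j)))"

definition admits_folded_cotangent_model ::
    "nat \<Rightarrow> 'a manifold \<Rightarrow> 'a two_form \<Rightarrow> (nat \<Rightarrow> 'a \<Rightarrow> real) \<Rightarrow> 'a \<Rightarrow> bool" where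
  "admits_folded_cotangent_model n M \<omega> F p \<longleftrightarrow>
     (\<exists>U r \<phi>. r > 0 \<and> leaf n M \<omega> F (points M) p \<subseteq> U \<and>
        diffeomorphism_on M U (cotangent_torus n) (torus n \<times> momentum_ball n r) \<phi> \<and>
        \<phi> ` leaf n M \<omega> F (points M) p = torus n \<times> {\<lambda>_. 0} \<and>
        pullback_eq M U (cotangent_torus n) \<phi> (twisted_form n) \<omega> \<and>
        {\<phi> ` leaf n M \<omega> F U q | q. q \<in> U} = {torus n \<times> {b} | b. b \<in> momentum_ball n r})"

end

theory Submission
  imports Defs
begin

text \<open>The counterexample is the Moebius band \<open>(\<theta>, z) \<sim> (\<theta> + \<pi>, -z)\<close>. The form \<open>z d\<theta> \<and> dz\<close> and the
  function \<open>z\<^sup>2\<close> descend to it although the band is not orientable. They form a folded integrable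
  system for which all points are regular, and the folding hypersurface is the core circle
  \<open>z = 0\<close>, which is a leaf. The momentum coordinate of a cotangent model near the core would
  vanish exactly on the core. But the complement of the core in a narrow band around it is
  connected, so the momentum would have a constant sign there and could not cover a ball around
  the origin.\<close>

section \<open>Smoothness of rational functions\<close>

text \<open>The form descends because z and dz both change sign under the gluing, while z^2 and the
  field -2 d/d\<theta> are invariant. The obstruction is topological: the core has a nontrivial
  normal line bundle, whereas the zero section of the model has a trivial one.

  The band is encoded as an algebraic set of lines instead of a quotient, so that transition maps
  and tensor components are rational in the charts and smoothness reduces to closure of rational
  functions under partial derivatives. A quarter turn relates the two charts, hence one coordinate
  expression per tensor is enough.

  With n = 1 the form vanishes at every point of Z, so its kernel there is the whole tangent plane:
  the required rank 2n - 2 is 0, and folded means that the differential vanishes on Z.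

  Two notions are not explicit. The Hamiltonian field is a choice, so its components must be shown
  unique. The leaf is a union over all integral manifolds, so it is bounded from above by a
  connectedness argument and from below by exhibiting arcs of the core.\<close>

lemma Euclidean_space_top_of_set: "Euclidean_space m = top_of_set {x. \<forall>i\<ge>m. x i = 0}"
  by (simp add: Euclidean_space_def euclidean_product_topology)

lemma coord_space_iff: "x \<in> coord_space m \<longleftrightarrow> (\<forall>i\<ge>m. x i = 0)"
  by (simp add: topspace_Euclidean_space)

lemma coord_space_upd: "x \<in> coord_space m \<Longrightarrow> i < m \<Longrightarrow> x(i := t) \<in> coord_space m"
  by (auto simp: coord_space_iff)

text \<open>Chart expressions agree with explicit formulas only on the range of a chart. As
  \<open>partial\<close> differentiates one-coordinate slices, such slices have to stay in that open
  set for nearby parameters before derivatives can be transferred.\<close>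

lemma eventually_upd_in_openin:
  assumes "openin (Euclidean_space m) S" "x \<in> S" "i < m"
  shows "\<forall>\<^sub>F t in nhds (x i). x(i := t) \<in> S"
proof -
  obtain T where T: "open T" "S = coord_space m \<inter> T"
    using assms(1) unfolding Euclidean_space_top_of_set openin_open by auto
  have "continuous_on UNIV (\<lambda>t. if j = i then t else x j)" for j
    by (cases "j = i") auto
  then have "continuous_on UNIV (\<lambda>t. x(i := t))"
    by (intro continuous_on_coordinatewise_then_product) (simp add: fun_upd_def)
  then have "open ((\<lambda>t. x(i := t)) -` T)"
    using T(1) by (rule open_vimage[rotated])
  moreover have "x i \<in> (\<lambda>t. x(i := t)) -` T"
    using assms(2) T(2) by simp
  ultimately have "\<forall>\<^sub>F t in nhds (x i). t \<in> (\<lambda>t. x(i := t)) -` T"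
    by (rule eventually_nhds_in_open)
  then show ?thesis
    by (rule eventually_mono) (use T(2) assms coord_space_upd in auto)
qed

lemma upd_derivative_transfer:
  assumes "((\<lambda>t. g (x(i := t))) has_real_derivative D) (at (x i))"
    and "openin (Euclidean_space m) S" "x \<in> S" "i < m" "\<And>y. y \<in> S \<Longrightarrow> f y = g y"
  shows "((\<lambda>t. f (x(i := t))) has_real_derivative D) (at (x i))"
proof -
  have "\<forall>\<^sub>F t in nhds (x i). f (x(i := t)) = g (x(i := t))"
    using eventually_upd_in_openin[OF assms(2-4)] by (rule eventually_mono) (rule assms(5))
  from DERIV_cong_ev[OF refl this refl] show ?thesis
    using assms(1) by simp
qed

lemma partial_eqI:
  assumes "((\<lambda>t. g (x(i := t))) has_real_derivative D) (at (x i))"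
    and "openin (Euclidean_space m) S" "x \<in> S" "i < m" "\<And>y. y \<in> S \<Longrightarrow> f y = g y"
  shows "partial i f x = D"
  unfolding partial_def using upd_derivative_transfer[OF assms] by (rule DERIV_imp_deriv)

section \<open>Rational functions and their smoothness\<close>

inductive rational_on :: "(nat \<Rightarrow> real) set \<Rightarrow> ((nat \<Rightarrow> real) \<Rightarrow> real) \<Rightarrow> bool" for S where
  rational_const: "rational_on S (\<lambda>x. c)"
| rational_coord: "rational_on S (\<lambda>x. x i)"
| rational_add: "rational_on S f \<Longrightarrow> rational_on S g \<Longrightarrow> rational_on S (\<lambda>x. f x + g x)"
| rational_mult: "rational_on S f \<Longrightarrow> rational_on S g \<Longrightarrow> rational_on S (\<lambda>x. f x * g x)"
| rational_inverse: "rational_on S f \<Longrightarrow> (\<forall>x\<in>S. f x \<noteq> 0) \<Longrightarrow> rational_on S (\<lambda>x. inverse (f x))"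

lemma rational_minus: "rational_on S f \<Longrightarrow> rational_on S (\<lambda>x. - f x)"
  using rational_mult[OF rational_const[of S "-1"], of f] by simp

lemma rational_divide:
  "rational_on S f \<Longrightarrow> rational_on S g \<Longrightarrow> (\<forall>x\<in>S. g x \<noteq> 0) \<Longrightarrow> rational_on S (\<lambda>x. f x / g x)"
  unfolding divide_inverse by (intro rational_mult rational_inverse)

lemma rational_power: "rational_on S f \<Longrightarrow> rational_on S (\<lambda>x. f x ^ k)"
proof (induction k)
  case 0
  show ?case using rational_const[of S 1] by simp
next
  case (Suc k)
  then show ?case using rational_mult[of S f "\<lambda>x. f x ^ k"] by simp
qed

lemmas rational_intros = rational_const rational_coord rational_add rational_mult rational_minus
  rational_divide rational_power

lemma continuous_on_coord: "continuous_on S (\<lambda>x :: nat \<Rightarrow> real. x i)"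
  by (rule continuous_on_product_then_coordinatewise) (rule continuous_on_id)

lemma rational_on_continuous: "rational_on S f \<Longrightarrow> continuous_on S f"
proof (induction rule: rational_on.induct)
  case (rational_inverse f)
  then show ?case by (intro continuous_on_inverse)
qed (rule continuous_on_const continuous_on_coord continuous_on_add continuous_on_mult;
    assumption?)+

text \<open>The class is closed under partial differentiation. This is what turns differentiability
  of every order into a plain induction on the order.\<close>

lemma rational_on_partial:
  assumes "rational_on S f"
  shows "\<exists>g. rational_on S g \<and>
    (\<forall>x\<in>S. ((\<lambda>t. f (x(i := t))) has_real_derivative g x) (at (x i)))"
  using assms
proof induction
  case (rational_const c)
  show ?case
    by (rule exI[of _ "\<lambda>x. 0"]) (auto intro: rational_on.rational_const)
next
  case (rational_coord j)
  show ?case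
    by (rule exI[of _ "\<lambda>x. if j = i then 1 else 0"]) (auto intro: rational_on.rational_const)
next
  case (rational_add f g)
  then obtain f' g' where *: "rational_on S f'" "rational_on S g'"
      "\<And>x. x \<in> S \<Longrightarrow> ((\<lambda>t. f (x(i := t))) has_real_derivative f' x) (at (x i))"
      "\<And>x. x \<in> S \<Longrightarrow> ((\<lambda>t. g (x(i := t))) has_real_derivative g' x) (at (x i))"
    by blast
  have "((\<lambda>t. f (x(i := t)) + g (x(i := t))) has_real_derivative f' x + g' x) (at (x i))"
    if "x \<in> S" for x
    using DERIV_add[OF *(3)[OF that] *(4)[OF that]] .
  moreover have "rational_on S (\<lambda>x. f' x + g' x)"
    by (intro rational_intros *)
  ultimately show ?case
    by blast
next
  case (rational_mult f g)
  then obtain f' g' where *: "rational_on S f'" "rational_on S g'"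
      "\<And>x. x \<in> S \<Longrightarrow> ((\<lambda>t. f (x(i := t))) has_real_derivative f' x) (at (x i))"
      "\<And>x. x \<in> S \<Longrightarrow> ((\<lambda>t. g (x(i := t))) has_real_derivative g' x) (at (x i))"
    by blast
  have "((\<lambda>t. f (x(i := t)) * g (x(i := t))) has_real_derivative
      f x * g' x + g x * f' x) (at (x i))"
    if "x \<in> S" for x
    using DERIV_mult[OF *(3)[OF that] *(4)[OF that]] by (simp add: algebra_simps)
  moreover have "rational_on S (\<lambda>x. f x * g' x + g x * f' x)"
    by (intro rational_intros * rational_mult.hyps)
  ultimately show ?case
    by blast
next
  case (rational_inverse f)
  then obtain f' where *: "rational_on S f'"
      "\<And>x. x \<in> S \<Longrightarrow> ((\<lambda>t. f (x(i := t))) has_real_derivative f' x) (at (x i))"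
    by blast
  have "((\<lambda>t. inverse (f (x(i := t)))) has_real_derivative - f' x / (f x)^2) (at (x i))"
    if "x \<in> S" for x
    using DERIV_inverse_fun[OF *(2)[OF that]] rational_inverse.hyps(2) that
    by (simp add: field_simps power2_eq_square)
  moreover have "rational_on S (\<lambda>x. - f' x / (f x)^2)"
    by (intro rational_intros * rational_inverse.hyps(1)) (use rational_inverse.hyps(2) in auto)
  ultimately show ?case
    by blast
qed

lemma rational_imp_C_on:
  assumes "openin (Euclidean_space m) S" "rational_on S g" "\<And>x. x \<in> S \<Longrightarrow> f x = g x"
  shows "C_on m k S f"
proof -
  have C0: "continuous_map (subtopology (Euclidean_space m) S) euclideanreal f"
    if g: "rational_on S g" and fg: "\<And>x. x \<in> S \<Longrightarrow> f x = g x" for f g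
  proof -
    have "continuous_map (subtopology (Euclidean_space m) S) euclideanreal g"
      using continuous_on_subset[OF rational_on_continuous[OF g], of "coord_space m \<inter> S"]
      by (simp add: Euclidean_space_top_of_set subtopology_subtopology)
    then show ?thesis
      by (rule continuous_map_eq) (use fg in auto)
  qed
  from assms(2,3) show ?thesis
  \<comment> \<open>Both functions vary: the next order deals with \<open>partial i f\<close>, which
    agrees with the rational derivative \<open>g'\<close> only on \<open>S\<close>.\<close>
  proof (induction k arbitrary: f g)
    case (0 f g)
    then show ?case
      using C0 by simp
  next
    case (Suc k f g)
    have D: "(\<forall>x\<in>S. (\<lambda>t. f (x(i := t))) differentiable at (x i)) \<and> C_on m k S (partial i f)"
      if "i < m" for i
    proof -
      obtain g' where g': "rational_on S g'"
        "\<And>x. x \<in> S \<Longrightarrow> ((\<lambda>t. g (x(i := t))) has_real_derivative g' x) (at (x i))"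
        using rational_on_partial[OF Suc(2)] by blast
      have *: "((\<lambda>t. f (x(i := t))) has_real_derivative g' x) (at (x i))" if "x \<in> S" for x
        by (rule upd_derivative_transfer[where g=g, OF g'(2)[OF that] assms(1) that \<open>i < m\<close> Suc(3)])
      have "partial i f x = g' x" if "x \<in> S" for x
        unfolding partial_def using *[OF that] by (rule DERIV_imp_deriv)
      then have "C_on m k S (partial i f)"
        by (rule Suc.IH[OF g'(1)])
      with * show ?thesis
        using real_differentiable_def by blast
    qed
    moreover have "continuous_map (subtopology (Euclidean_space m) S) euclideanreal f"
      using C0[OF Suc(2,3)] .
    ultimately show ?case
      by simp
  qed
qed

lemma rational_imp_smooth_on:
  assumes "openin (Euclidean_space m) S" "rational_on S g" "\<And>x. x \<in> S \<Longrightarrow> f x = g x"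
  shows "smooth_on m S f"
  unfolding smooth_on_def using rational_imp_C_on[OF assms] by blast

text \<open>A continuous two-sided inverse gives the embedding. Since \<open>chart_inv\<close> is a
  choice of preimage, its identification with the explicit \<open>e\<close> is what makes later
  coordinate computations possible.\<close>

lemma is_chartI:
  assumes "openin T D" and k: "continuous_map (subtopology T D) (Euclidean_space m) k"
    and e: "continuous_map (Euclidean_space m) (subtopology T D) e"
    and ke: "\<And>x. x \<in> coord_space m \<Longrightarrow> k (e x) = x" and ek: "\<And>q. q \<in> D \<Longrightarrow> e (k q) = q"
  shows "is_chart m T (D, k)" and "k ` D = coord_space m"
    and "\<And>x. x \<in> coord_space m \<Longrightarrow> chart_inv (D, k) x = e x"
proof -
  have D: "topspace (subtopology T D) = D"
    using openin_subset[OF assms(1)] by auto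
  have eD: "e x \<in> D" if "x \<in> coord_space m" for x
    using continuous_map_funspace[OF e] that D by auto
  show im: "k ` D = coord_space m"
  proof
    show "k ` D \<subseteq> coord_space m"
      using continuous_map_image_subset_topspace[OF k] D by simp
    show "coord_space m \<subseteq> k ` D"
    proof
      fix x assume "x \<in> coord_space m"
      then show "x \<in> k ` D"
        using image_eqI[of x k "e x" D] eD ke by simp
    qed
  qed
  have hm: "homeomorphic_maps (subtopology T D) (Euclidean_space m) k e"
    unfolding homeomorphic_maps_def using assms D by auto
  then have "embedding_map (subtopology T D) (Euclidean_space m) k"
    using D im by (auto simp: embedding_map_def homeomorphic_map_maps)
  then show "is_chart m T (D, k)"
    using assms(1) im by (simp add: is_chart_def)
  show "chart_inv (D, k) x = e x" if "x \<in> coord_space m" for x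
  proof -
    have "inj_on k D"
      by (rule inj_on_inverseI[where g=e]) (rule ek)
    then show ?thesis
      unfolding chart_inv_def fst_conv snd_conv
      using eD[OF that] ke[OF that] by (rule inv_into_f_eq)
  qed
qed

lemma is_chart_image_openin:
  assumes "is_chart m T c" "openin T V"
  shows "openin (Euclidean_space m) (snd c ` (fst c \<inter> V))"
proof -
  have op: "openin (Euclidean_space m) (snd c ` fst c)" "openin T (fst c)"
    and h: "homeomorphic_map (subtopology T (fst c))
        (subtopology (Euclidean_space m) (snd c ` topspace (subtopology T (fst c)))) (snd c)"
    using assms(1) by (auto simp: is_chart_def embedding_map_def)
  have ts: "topspace (subtopology T (fst c)) = fst c"
    using openin_subset[OF op(2)] by auto
  have "openin (subtopology T (fst c)) (fst c \<inter> V)"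
    using assms(2) by (simp add: openin_subtopology_Int2)
  then have "openin (subtopology (Euclidean_space m) (snd c ` fst c)) (snd c ` (fst c \<inter> V))"
    using h homeomorphic_imp_open_map unfolding ts open_map_def by blast
  then show ?thesis
    using op(1) openin_trans_full by blast
qed

section \<open>The Moebius band as the manifold of lines of the plane\<close>

definition vec2 :: "real \<Rightarrow> real \<Rightarrow> nat \<Rightarrow> real" where
  "vec2 a b i = (if i = 0 then a else if i = 1 then b else 0)"

definition vec4 :: "real \<Rightarrow> real \<Rightarrow> real \<Rightarrow> real \<Rightarrow> nat \<Rightarrow> real" where
  "vec4 a b c d i = (if i = 0 then a else if i = 1 then b else if i = 2 then c
     else if i = 3 then d else 0)"

lemma vec2_simps [simp]: "vec2 a b 0 = a" "vec2 a b (Suc 0) = b" "2 \<le> i \<Longrightarrow> vec2 a b i = 0"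
  by (auto simp: vec2_def)

lemma vec4_simps [simp]: "vec4 a b c d 0 = a" "vec4 a b c d (Suc 0) = b" "vec4 a b c d 2 = c"
    "vec4 a b c d 3 = d" "4 \<le> i \<Longrightarrow> vec4 a b c d i = 0"
  by (auto simp: vec4_def)

lemma vec2_in_coord_space [simp]: "vec2 a b \<in> coord_space 2"
  by (simp add: coord_space_iff)

lemma vec2_collapse: "x \<in> coord_space 2 \<Longrightarrow> vec2 (x 0) (x 1) = x"
  by (auto simp: coord_space_iff vec2_def fun_eq_iff)

lemma vec4_collapse:
  fixes q :: "nat \<Rightarrow> real"
  shows "\<forall>i\<ge>4. q i = 0 \<Longrightarrow> vec4 (q 0) (q 1) (q 2) (q 3) = q"
proof
  fix i :: nat assume "\<forall>i\<ge>4. q i = 0"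
  moreover have "i = 0 \<or> i = 1 \<or> i = 2 \<or> i = 3 \<or> i \<ge> 4" by linarith
  ultimately show "vec4 (q 0) (q 1) (q 2) (q 3) i = q i" by (auto simp: vec4_def)
qed

lemma less_2_cases_All: "(\<forall>i<2. P i) \<longleftrightarrow> P 0 \<and> P (Suc 0)" for P :: "nat \<Rightarrow> bool"
  by (auto simp: numeral_2_eq_2 less_Suc_eq)

lemma sum_less_2: "(\<Sum>i<2. g i) = g 0 + g (Suc 0)" for g :: "nat \<Rightarrow> real"
  by (simp add: numeral_2_eq_2)

lemma continuous_on_vec2 [continuous_intros]:
  "continuous_on S f \<Longrightarrow> continuous_on S g \<Longrightarrow> continuous_on S (\<lambda>x. vec2 (f x) (g x))"
proof (rule continuous_on_coordinatewise_then_product)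
  fix i assume "continuous_on S f" "continuous_on S g"
  then show "continuous_on S (\<lambda>x. vec2 (f x) (g x) i)"
    unfolding vec2_def by (cases "i = 0"; cases "i = 1"; simp)
qed

lemma continuous_on_vec4 [continuous_intros]:
  "continuous_on S f \<Longrightarrow> continuous_on S g \<Longrightarrow> continuous_on S h \<Longrightarrow> continuous_on S k \<Longrightarrow>
    continuous_on S (\<lambda>x. vec4 (f x) (g x) (h x) (k x))"
proof (rule continuous_on_coordinatewise_then_product)
  fix i assume "continuous_on S f" "continuous_on S g" "continuous_on S h" "continuous_on S k"
  then show "continuous_on S (\<lambda>x. vec4 (f x) (g x) (h x) (k x) i)"
    unfolding vec4_def by (cases "i = 0"; cases "i = 1"; cases "i = 2"; cases "i = 3"; simp)
qed

lemma add_square_nonzero [simp]: "1 + x\<^sup>2 \<noteq> (0::real)"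
  by (metis add_pos_nonneg less_irrefl zero_le_power2 zero_less_one)

text \<open>The line \<open>\<alpha> x + \<beta> y = \<gamma>\<close> of the plane, normalized by \<open>\<alpha>\<^sup>2 + \<beta>\<^sup>2 = 1\<close>, is encoded by the
  sign-independent products \<open>(\<alpha>\<^sup>2, \<alpha>\<beta>, \<alpha>\<gamma>, \<beta>\<gamma>)\<close>; the lines form a Moebius band.\<close>

definition moebius :: "(nat \<Rightarrow> real) set" where
  "moebius = {q. (\<forall>i\<ge>4. q i = 0) \<and> (q 1)\<^sup>2 = q 0 * (1 - q 0) \<and>
     q 2 * q 1 = q 3 * q 0 \<and> q 2 * (1 - q 0) = q 3 * q 1}"

text \<open>With \<open>x\<^sub>0 = \<beta>/\<alpha>, x\<^sub>1 = \<gamma>/\<alpha>\<close> in \<open>chartA\<close> and \<open>x\<^sub>0 = -\<alpha>/\<beta>, x\<^sub>1 = \<gamma>/\<beta>\<close> in \<open>chartB\<close>, the form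
  \<open>z d\<theta> \<and> dz\<close>, the function \<open>z\<^sup>2\<close> and its Hamiltonian field have the same coordinate expressions in
  both charts.\<close>

definition chartA :: "(nat \<Rightarrow> real) chart" where
  "chartA = ({q \<in> moebius. q 0 \<noteq> 0}, \<lambda>q. vec2 (q 1 / q 0) (q 2 / q 0))"

definition chartB :: "(nat \<Rightarrow> real) chart" where
  "chartB = ({q \<in> moebius. q 0 \<noteq> 1}, \<lambda>q. vec2 (- q 1 / (1 - q 0)) (q 3 / (1 - q 0)))"

text \<open>For x0 = tan \<theta> and x1 = z / cos \<theta> the factor 1 / (1 + x0^2) is cos^2
  \<theta>, so the entries are cos^2 \<theta>, cos \<theta> sin \<theta>, z cos \<theta> and z sin
  \<theta>. In \<open>pointB\<close> the coordinates are -cot \<theta> and z / sin \<theta>.\<close>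

definition pointA :: "(nat \<Rightarrow> real) \<Rightarrow> nat \<Rightarrow> real" where
  "pointA x = vec4 (1 / (1 + (x 0)\<^sup>2)) (x 0 / (1 + (x 0)\<^sup>2))
     (x 1 / (1 + (x 0)\<^sup>2)) (x 0 * x 1 / (1 + (x 0)\<^sup>2))"

definition pointB :: "(nat \<Rightarrow> real) \<Rightarrow> nat \<Rightarrow> real" where
  "pointB x = vec4 ((x 0)\<^sup>2 / (1 + (x 0)\<^sup>2)) (- x 0 / (1 + (x 0)\<^sup>2))
     (- x 0 * x 1 / (1 + (x 0)\<^sup>2)) (x 1 / (1 + (x 0)\<^sup>2))"

definition moebius_mfd :: "(nat \<Rightarrow> real) manifold" where
  "moebius_mfd = \<lparr>mdim = 2, mtop = top_of_set moebius, matlas = {chartA, chartB}\<rparr>"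

lemma moebius_mfd_simps [simp]: "mdim moebius_mfd = 2" "mtop moebius_mfd = top_of_set moebius"
    "matlas moebius_mfd = {chartA, chartB}"
  "points moebius_mfd = moebius"
  by (simp_all add: moebius_mfd_def)

section \<open>Explicit inverses of the two charts\<close>

lemma pointA_in: "pointA x \<in> moebius" "pointA x 0 \<noteq> 0"
proof -
  define a where "a = inverse (1 + (x 0)\<^sup>2)"
  have a: "1 - a = a * (x 0)\<^sup>2"
    by (simp add: a_def field_simps)
  have p: "pointA x = vec4 a (x 0 * a) (x 1 * a) (x 0 * x 1 * a)"
    by (simp add: pointA_def a_def divide_inverse)
  show "pointA x \<in> moebius"
    unfolding p by (simp add: moebius_def a power2_eq_square mult_ac)
  show "pointA x 0 \<noteq> 0"
    by (simp add: p a_def)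
qed

lemma pointB_in: "pointB x \<in> moebius" "pointB x 0 \<noteq> 1"
proof -
  define a where "a = inverse (1 + (x 0)\<^sup>2)"
  have a: "1 - (x 0)\<^sup>2 * a = a"
    by (simp add: a_def field_simps)
  have p: "pointB x = vec4 ((x 0)\<^sup>2 * a) (- x 0 * a) (- x 0 * x 1 * a) (x 1 * a)"
    by (simp add: pointB_def a_def divide_inverse)
  show "pointB x \<in> moebius"
    unfolding p by (simp add: moebius_def a) (simp add: power2_eq_square mult_ac)
  have "a \<noteq> 0"
    by (simp add: a_def)
  then show "pointB x 0 \<noteq> 1"
    using a by (auto simp: p)
qed

lemma chartA_pointA:
  assumes "x \<in> coord_space 2"
  shows "snd chartA (pointA x) = x"
proof -
  have "snd chartA (pointA x) = vec2 (x 0) (x 1)"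
    by (simp add: chartA_def pointA_def)
  then show ?thesis
    using vec2_collapse[OF assms] by simp
qed

lemma chartB_pointB:
  assumes "x \<in> coord_space 2"
  shows "snd chartB (pointB x) = x"
proof -
  have "1 - (x 0)\<^sup>2 / (1 + (x 0)\<^sup>2) = 1 / (1 + (x 0)\<^sup>2)"
    by (simp add: field_simps)
  then have "snd chartB (pointB x) = vec2 (x 0) (x 1)"
    by (simp add: chartB_def pointB_def)
  then show ?thesis
    using vec2_collapse[OF assms] by simp
qed

lemma pointA_chartA: assumes "q \<in> fst chartA" shows "pointA (snd chartA q) = q"
proof -
  have q: "q \<in> moebius" "q 0 \<noteq> 0"
    using assms by (auto simp: chartA_def)
  then have e: "(q 1)\<^sup>2 = q 0 * (1 - q 0)" "q 2 * q 1 = q 3 * q 0"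
      "vec4 (q 0) (q 1) (q 2) (q 3) = q"
    using vec4_collapse[of q] by (auto simp: moebius_def)
  \<comment> \<open>The first equation of the band, divided by the square of \<open>q 0\<close>, is
    1 + tan^2 \<theta> = 1 / cos^2 \<theta>.\<close>
  have *: "1 + (q 1 / q 0)\<^sup>2 = 1 / q 0"
    using q(2) e(1) by (simp add: power_divide) (simp add: field_simps power2_eq_square)
  have "pointA (snd chartA q) = vec4 (q 0) (q 1) (q 2) (q 1 * q 2 / q 0)"
    using q(2) * by (simp add: chartA_def pointA_def)
  moreover have "q 1 * q 2 / q 0 = q 3"
    using e(2) q(2) by (simp add: field_simps)
  ultimately show ?thesis
    using e(3) by simp
qed

lemma pointB_chartB: assumes "q \<in> fst chartB" shows "pointB (snd chartB q) = q"
proof -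
  have q: "q \<in> moebius" "1 - q 0 \<noteq> 0"
    using assms by (auto simp: chartB_def)
  then have e: "(q 1)\<^sup>2 = q 0 * (1 - q 0)" "q 2 * (1 - q 0) = q 3 * q 1"
      "vec4 (q 0) (q 1) (q 2) (q 3) = q"
    using vec4_collapse[of q] by (auto simp: moebius_def)
  have *: "(q 1 / (1 - q 0))\<^sup>2 = q 0 / (1 - q 0)"
    unfolding power_divide e(1) using q(2) by (simp add: power2_eq_square)
  have **: "1 + (q 1 / (1 - q 0))\<^sup>2 = 1 / (1 - q 0)"
    unfolding * using q(2) by (simp add: field_simps)
  have ***: "(q 1 / (1 - q 0))\<^sup>2 * (1 - q 0) = q 0"
    unfolding * using q(2) by simp
  have "pointB (snd chartB q) = vec4 (q 0) (q 1) (q 1 * q 3 / (1 - q 0)) (q 3)"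
    using q(2) ** *** by (simp add: chartB_def pointB_def)
  moreover have "q 1 * q 3 / (1 - q 0) = q 2"
    using e(2) q(2) by (simp add: field_simps)
  ultimately show ?thesis
    using e(3) by simp
qed

lemma continuous_pointA: "continuous_on S pointA"
  unfolding pointA_def by (intro continuous_intros continuous_on_coord) auto

lemma continuous_pointB: "continuous_on S pointB"
  unfolding pointB_def by (intro continuous_intros continuous_on_coord) auto

lemma openin_fst_chart: "openin (top_of_set moebius) (fst chartA)"
    "openin (top_of_set moebius) (fst chartB)"
proof -
  have "open ((\<lambda>q :: nat \<Rightarrow> real. q 0) -` (- {a}))" for a
    by (intro open_vimage continuous_on_coord) auto
  moreover have "fst chartA = moebius \<inter> (\<lambda>q. q 0) -` (- {0})"
      "fst chartB = moebius \<inter> (\<lambda>q. q 0) -` (- {1})"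
    by (auto simp: chartA_def chartB_def)
  ultimately show "openin (top_of_set moebius) (fst chartA)"
      "openin (top_of_set moebius) (fst chartB)"
    by (simp_all only: openin_open_Int)
qed

lemma continuous_chart: "continuous_on (fst chartA) (snd chartA)"
    "continuous_on (fst chartB) (snd chartB)"
  unfolding chartA_def chartB_def snd_conv fst_conv
  by (intro continuous_intros continuous_on_coord; simp)+

lemma continuous_map_Euclidean_space_iff:
  "continuous_map (top_of_set S) (Euclidean_space m) f \<longleftrightarrow> continuous_on S f \<and> f ` S \<subseteq> coord_space m"
  "continuous_map (Euclidean_space m) (top_of_set T) g \<longleftrightarrow> continuous_on (coord_space m) g \<and>
      g ` coord_space m \<subseteq> T"
  by (auto simp: Euclidean_space_top_of_set continuous_map_in_subtopology)

text \<open>Both charts have all of \<open>coord_space 2\<close> as range. Stating the facts for an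
  arbitrary member of the atlas lets later proofs treat the two charts at once.\<close>

lemma atlas_chart:
  assumes "c \<in> {chartA, chartB}"
  shows chart_is_chart: "is_chart 2 (top_of_set moebius) c"
    and chart_range: "snd c ` fst c = coord_space 2"
    and chart_of_inv: "\<And>x. x \<in> coord_space 2 \<Longrightarrow> snd c (chart_inv c x) = x"
    and inv_of_chart: "\<And>q. q \<in> fst c \<Longrightarrow> chart_inv c (snd c q) = q"
    and chart_inv_in: "\<And>x. x \<in> coord_space 2 \<Longrightarrow> chart_inv c x \<in> fst c"
    and chart_inv_eq: "\<And>x. x \<in> coord_space 2 \<Longrightarrow> chart_inv c x =
      (if c = chartA then pointA x else pointB x)"
proof -
  have sub: "fst chartA \<subseteq> moebius" "fst chartB \<subseteq> moebius"
    by (auto simp: chartA_def chartB_def)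
  have topA: "subtopology (top_of_set moebius) (fst chartA) = top_of_set (fst chartA)"
   and topB: "subtopology (top_of_set moebius) (fst chartB) = top_of_set (fst chartB)"
    using sub by (auto simp: subtopology_subtopology inf_absorb2)
  have kA: "continuous_map (subtopology (top_of_set moebius) (fst chartA)) (Euclidean_space 2)
      (snd chartA)"
    unfolding topA continuous_map_Euclidean_space_iff
    using continuous_chart by (auto simp: chartA_def)
  have eA: "continuous_map (Euclidean_space 2) (subtopology (top_of_set moebius) (fst chartA))
      pointA"
    unfolding topA continuous_map_Euclidean_space_iff
    using continuous_pointA pointA_in by (auto simp: chartA_def)
  note A = is_chartI[OF openin_fst_chart(1) kA eA chartA_pointA pointA_chartA,
      unfolded prod.collapse]
  have kB: "continuous_map (subtopology (top_of_set moebius) (fst chartB)) (Euclidean_space 2)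
      (snd chartB)"
    unfolding topB continuous_map_Euclidean_space_iff
    using continuous_chart by (auto simp: chartB_def)
  have eB: "continuous_map (Euclidean_space 2) (subtopology (top_of_set moebius) (fst chartB))
      pointB"
    unfolding topB continuous_map_Euclidean_space_iff
    using continuous_pointB pointB_in by (auto simp: chartB_def)
  note B = is_chartI[OF openin_fst_chart(2) kB eB chartB_pointB pointB_chartB,
      unfolded prod.collapse]
  show "is_chart 2 (top_of_set moebius) c" and r: "snd c ` fst c = coord_space 2"
    and eq: "\<And>x. x \<in> coord_space 2 \<Longrightarrow> chart_inv c x = (if c = chartA then pointA x else pointB x)"
    using assms A B by auto
  show "snd c (chart_inv c x) = x" "chart_inv c x \<in> fst c" if "x \<in> coord_space 2" for x
    using that r f_inv_into_f[of x "snd c" "fst c"] inv_into_into[of x "snd c" "fst c"]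
    unfolding chart_inv_def by auto
  show "chart_inv c (snd c q) = q" if "q \<in> fst c" for q
  proof -
    have "snd c q \<in> coord_space 2" using that r by blast
    from eq[OF this] show ?thesis
      using that assms pointA_chartA pointB_chartB by (auto split: if_splits)
  qed
qed

section \<open>Transition maps and the smooth structure\<close>

lemma rational_if:
  "rational_on S f \<Longrightarrow> rational_on S g \<Longrightarrow> rational_on S (\<lambda>x. if P then f x else g x)"
  by (cases P) simp_all

text \<open>\<open>chart_inv_eq\<close> chooses its formula by testing \<open>c = chartA\<close>, so
  using it for \<open>chartB\<close> needs the charts to differ. The line through the origin with
  normal angle 0 lies in \<open>chartA\<close> only.\<close>

lemma chartA_neq_chartB: "chartA \<noteq> chartB"
proof
  assume "chartA = chartB"
  moreover have "pointA (vec2 0 0) \<in> fst chartA"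
    using pointA_in[of "vec2 0 0"] by (auto simp: chartA_def)
  ultimately have "pointA (vec2 0 0) \<in> fst chartB"
    by simp
  then show False
    by (simp add: chartB_def pointA_def)
qed

text \<open>\<open>chartB\<close> is \<open>chartA\<close> with \<theta> replaced by \<theta> -
  pi/2, and tan (\<theta> - pi/2) = -1 / tan \<theta>. The sign \<sigma> is 1 from
  \<open>chartA\<close> to \<open>chartB\<close> and -1 on the way back. The Jacobian determinant
  \<sigma> / x0^3 takes both signs on the overlap, which is where the band fails to be oriented by
  these charts.\<close>

lemma transition_overlap:
  assumes "c \<in> {chartA, chartB}" "d \<in> {chartA, chartB}" "c \<noteq> d"
  shows "\<exists>\<sigma>. \<sigma> * \<sigma> = 1 \<and> snd c ` (fst c \<inter> fst d) = {x \<in> coord_space 2. x 0 \<noteq> 0} \<and>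
    (\<forall>x\<in>{x \<in> coord_space 2. x 0 \<noteq> 0}. snd d (chart_inv c x) = vec2 (- 1 / x 0) (\<sigma> * x 1 / x 0))"
proof -
  have *: "\<exists>\<sigma>. \<sigma> * \<sigma> = 1 \<and> (\<forall>x\<in>coord_space 2. (chart_inv c x \<in> fst d \<longleftrightarrow> x 0 \<noteq> 0) \<and>
     (x 0 \<noteq> 0 \<longrightarrow> snd d (chart_inv c x) = vec2 (- 1 / x 0) (\<sigma> * x 1 / x 0)))"
  proof (cases "c = chartA")
    case True
    then have d: "d = chartB" using assms by auto
    have 1: "1 - 1 / (1 + (x 0)\<^sup>2) = (x 0)\<^sup>2 / (1 + (x 0)\<^sup>2)" for x :: "nat \<Rightarrow> real"
      by (simp add: field_simps)
    show ?thesis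
      by (rule exI[of _ 1])
        (use pointA_in(1) in \<open>auto simp: True d chart_inv_eq chartB_def pointA_def 1;
            simp add: power2_eq_square\<close>)
  next
    case False
    then have c: "c = chartB" "d = chartA" using assms by auto
    show ?thesis
      by (rule exI[of _ "-1"])
        (use pointB_in(1) chartA_neq_chartB
            in \<open>auto simp: c chart_inv_eq chartA_def pointB_def; simp add: power2_eq_square\<close>)
  qed
  then obtain \<sigma> where \<sigma>: "\<sigma> * \<sigma> = 1" "\<And>x. x \<in> coord_space 2 \<Longrightarrow> chart_inv c x \<in> fst d \<longleftrightarrow> x 0 \<noteq> 0"
    "\<And>x. x \<in> coord_space 2 \<Longrightarrow> x 0 \<noteq> 0 \<Longrightarrow> snd d (chart_inv c x) = vec2 (- 1 / x 0) (\<sigma> * x 1 / x 0)"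
    by blast
  have "snd c ` (fst c \<inter> fst d) = {x \<in> coord_space 2. x 0 \<noteq> 0}"
  proof (intro equalityI subsetI)
    fix x assume "x \<in> snd c ` (fst c \<inter> fst d)"
    then obtain q where q: "q \<in> fst c" "q \<in> fst d" "x = snd c q" by auto
    then have x: "x \<in> coord_space 2"
      using chart_range[OF assms(1)] by auto
    moreover have "chart_inv c x = q"
      using q inv_of_chart[OF assms(1)] by simp
    ultimately show "x \<in> {x \<in> coord_space 2. x 0 \<noteq> 0}"
      using \<sigma>(2)[OF x] q(2) by simp
  next
    fix x assume "x \<in> {x \<in> coord_space 2. x 0 \<noteq> 0}"
    then have x: "x \<in> coord_space 2" "chart_inv c x \<in> fst d"
      using \<sigma>(2) by auto
    then show "x \<in> snd c ` (fst c \<inter> fst d)"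
      using image_eqI[of x "snd c" "chart_inv c x" "fst c \<inter> fst d"]
        chart_of_inv[OF assms(1) x(1)] chart_inv_in[OF assms(1) x(1)] by simp
  qed
  then show ?thesis
    using \<sigma> by auto
qed

lemma transition_cases:
  assumes "c \<in> {chartA, chartB}" "d \<in> {chartA, chartB}"
  obtains (same) "c = d"
    | (flip) \<sigma> where "c \<noteq> d" "\<sigma> * \<sigma> = 1" "snd c ` (fst c \<inter> fst d) = {x \<in> coord_space 2. x 0 \<noteq> 0}"
      "\<And>x. x \<in> coord_space 2 \<Longrightarrow> x 0 \<noteq> 0 \<Longrightarrow> snd d (chart_inv c x) = vec2 (- 1 / x 0) (\<sigma> * x 1 / x 0)"
  using transition_overlap[OF assms] by blast

lemma openin_overlap:
  assumes "c \<in> {chartA, chartB}" "d \<in> {chartA, chartB}"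
  shows "openin (Euclidean_space 2) (snd c ` (fst c \<inter> fst d))"
  using is_chart_image_openin[OF chart_is_chart[OF assms(1)]] openin_fst_chart assms(2) by auto

lemma second_countable_euclidean:
  "second_countable (euclidean :: 'a :: second_countable_topology topology)"
proof -
  obtain B :: "'a set set" where B: "countable B" "topological_basis B"
    using ex_countable_basis by blast
  then show ?thesis
    unfolding second_countable_def topological_basis_iff[OF topological_basis_open[OF B(2)]]
    by (metis open_openin topological_basis_def topological_basisE)
qed

lemma smooth_manifold_moebius: "smooth_manifold moebius_mfd"
proof -
  have "smooth_on 2 (snd c ` (fst c \<inter> fst d)) (\<lambda>x. snd d (chart_inv c x) i)"
    if cd: "c \<in> {chartA, chartB}" "d \<in> {chartA, chartB}" and "i < 2" for c d i
    using cd
  proof (cases rule: transition_cases)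
    case same
    show ?thesis
      by (rule rational_imp_smooth_on[OF openin_overlap[OF cd] rational_coord[of _ i]])
        (use same chart_range[OF cd(1)] chart_of_inv[OF cd(1)] in auto)
  next
    case (flip \<sigma>)
    have "rational_on (snd c ` (fst c \<inter> fst d)) (\<lambda>x. if i = 0 then - 1 / x 0 else \<sigma> * x 1 / x 0)"
      unfolding flip(3) by (intro rational_if rational_intros) simp_all
    then show ?thesis
      by (rule rational_imp_smooth_on[OF openin_overlap[OF cd]])
        (use \<open>i < 2\<close> in \<open>auto simp: flip(3,4) vec2_def\<close>)
  qed
  moreover have "fst chartA \<union> fst chartB = moebius"
    by (auto simp: chartA_def chartB_def)
  moreover have "Hausdorff_space (top_of_set moebius)" "second_countable (top_of_set moebius)"
    by (auto intro!: Hausdorff_space_subtopology second_countable_subtopology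
        second_countable_euclidean)
  moreover have "\<forall>c\<in>{chartA, chartB}. is_chart 2 (top_of_set moebius) c"
    using chart_is_chart by blast
  ultimately show ?thesis
    unfolding smooth_manifold_def moebius_mfd_simps by auto
qed

lemma snd_chart_in: "c \<in> {chartA, chartB} \<Longrightarrow> q \<in> fst c \<Longrightarrow> snd c q \<in> coord_space 2"
  using chart_range by blast

section \<open>Jacobians of the transition maps\<close>

lemma jacobian_same:
  assumes "c \<in> {chartA, chartB}" "q \<in> fst c" "i < 2" "j < 2"
  shows "jacobian c c (\<lambda>x. x) q i j = (if i = j then 1 else 0)"
  unfolding jacobian_def
proof (rule partial_eqI[where S="coord_space 2" and m=2])
  show "((\<lambda>t. ((snd c q)(j := t)) i) has_real_derivative (if i = j then 1 else 0)) (at (snd c q j))"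
    by auto
  show "openin (Euclidean_space 2) (coord_space 2)" by simp
qed (use assms chart_of_inv snd_chart_in in auto)

lemma jacobian_flip:
  assumes "c \<in> {chartA, chartB}" "d \<in> {chartA, chartB}" "c \<noteq> d" "q \<in> fst c \<inter> fst d"
  obtains \<sigma> x0 x1 where "\<sigma> * \<sigma> = 1" "snd c q = vec2 x0 x1" "x0 \<noteq> 0"
      "snd d q = vec2 (- 1 / x0) (\<sigma> * x1 / x0)"
    "jacobian c d (\<lambda>x. x) q 0 0 = 1 / x0\<^sup>2" "jacobian c d (\<lambda>x. x) q 0 (Suc 0) = 0"
    "jacobian c d (\<lambda>x. x) q (Suc 0) 0 = - \<sigma> * x1 / x0\<^sup>2"
        "jacobian c d (\<lambda>x. x) q (Suc 0) (Suc 0) = \<sigma> / x0"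
proof -
  obtain \<sigma> where \<sigma>: "\<sigma> * \<sigma> = 1" "snd c ` (fst c \<inter> fst d) = {x \<in> coord_space 2. x 0 \<noteq> 0}"
    "\<And>x. x \<in> coord_space 2 \<Longrightarrow> x 0 \<noteq> 0 \<Longrightarrow> snd d (chart_inv c x) = vec2 (- 1 / x 0) (\<sigma> * x 1 / x 0)"
    using assms(1,2) by (cases rule: transition_cases) (use assms(3) in auto)
  define x0 x1 where "x0 = snd c q 0" and "x1 = snd c q 1"
  have mem: "snd c q \<in> {x \<in> coord_space 2. x 0 \<noteq> 0}"
    using \<sigma>(2) assms(4) by blast
  then have x: "snd c q = vec2 x0 x1" "x0 \<noteq> 0"
    using vec2_collapse[of "snd c q"] by (auto simp: x0_def x1_def)
  have J: "jacobian c d (\<lambda>x. x) q i j = D"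
    if "((\<lambda>t. vec2 (- 1 / ((vec2 x0 x1)(j := t)) 0) (\<sigma> * ((vec2 x0 x1)(j := t)) 1 /
        ((vec2 x0 x1)(j := t)) 0) i)
      has_real_derivative D) (at (vec2 x0 x1 j))" "j < 2" for i j D
    unfolding jacobian_def
  proof (rule partial_eqI)
    show "openin (Euclidean_space 2) {x \<in> coord_space 2. x 0 \<noteq> 0}"
      using openin_overlap[OF assms(1,2)] \<sigma>(2) by simp
    show "((\<lambda>t. vec2 (- 1 / ((snd c q)(j := t)) 0) (\<sigma> * ((snd c q)(j := t)) 1 /
        ((snd c q)(j := t)) 0) i)
      has_real_derivative D) (at (snd c q j))"
      unfolding x(1) by (rule that)
  qed (use mem \<sigma>(3) that(2) in auto)
  show thesis
  proof (rule that[OF \<sigma>(1) x])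
    have "chart_inv c (snd c q) = q"
      using inv_of_chart[OF assms(1)] assms(4) by simp
    then show "snd d q = vec2 (- 1 / x0) (\<sigma> * x1 / x0)"
      using \<sigma>(3)[of "snd c q"] mem by (simp add: x0_def x1_def)
    show "jacobian c d (\<lambda>x. x) q 0 0 = 1 / x0\<^sup>2" "jacobian c d (\<lambda>x. x) q 0 (Suc 0) = 0"
      "jacobian c d (\<lambda>x. x) q (Suc 0) 0 = - \<sigma> * x1 / x0\<^sup>2"
          "jacobian c d (\<lambda>x. x) q (Suc 0) (Suc 0) = \<sigma> / x0"
      by (rule J; use x(2) in \<open>auto intro!: derivative_eq_intros simp: power2_eq_square\<close>)+
  qed
qed

text \<open>Substituting \<theta> = arctan x0 and z = x1 cos \<theta> gives z d\<theta> \<and> dz =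
  x1 cos^4 \<theta> dx0 \<and> dx1, and cos^2 \<theta> = 1 / (1 + x0^2).\<close>

definition fold_coeff :: "(nat \<Rightarrow> real) \<Rightarrow> real" where
  "fold_coeff x = x 1 / (1 + (x 0)\<^sup>2)\<^sup>2"

definition fold_form :: "(nat \<Rightarrow> real) two_form" where
  "fold_form c q i j = (if i = 0 \<and> j = 1 then fold_coeff (snd c q)
     else if i = 1 \<and> j = 0 then - fold_coeff (snd c q) else 0)"

text \<open>The entries are \<alpha>\<gamma> and \<beta>\<gamma> with a unit normal (\<alpha>,
  \<beta>), so the value is \<gamma>^2 = z^2. Being polynomial in the ambient coordinates, it is
  defined without charts.\<close>

definition sq_dist :: "(nat \<Rightarrow> real) \<Rightarrow> real" where
  "sq_dist q = (q 2)\<^sup>2 + (q 3)\<^sup>2"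

text \<open>This is -2 d/d\<theta> at constant z: along it x0 = tan \<theta> has velocity -2 (1 +
  x0^2) and x1 = z / cos \<theta> has velocity -2 x0 x1.\<close>

definition rot_field :: "(nat \<Rightarrow> real) vector_field" where
  "rot_field c q = vec2 (- 2 * (1 + (snd c q 0)\<^sup>2)) (- 2 * snd c q 0 * snd c q 1)"

lemma smooth_two_form_fold_form: "smooth_two_form moebius_mfd fold_form"
proof -
  have A: "smooth_on 2 (coord_space 2) (\<lambda>x. fold_form c (chart_inv c x) i j)"
    if c: "c \<in> {chartA, chartB}" for c i j
  proof (rule rational_imp_smooth_on)
    show "rational_on (coord_space 2) (\<lambda>x. (if i = 0 \<and> j = 1 then 1 else if i = 1 \<and> j = 0 then - 1
        else 0) *
      (x 1 / (1 + (x 0)\<^sup>2)\<^sup>2))"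
      by (intro rational_intros) auto
    show "openin (Euclidean_space 2) (coord_space 2)" by simp
  qed (use chart_of_inv[OF c] in \<open>auto simp: fold_form_def fold_coeff_def\<close>)
  have B: "fold_form c q j i = - fold_form c q i j" for c q i j
    by (auto simp: fold_form_def)
  have C: "fold_form c q i j = (\<Sum>k<2. \<Sum>l<2.
          fold_form d q k l * jacobian c d (\<lambda>x. x) q k i * jacobian c d (\<lambda>x. x) q l j)"
    if cd: "c \<in> {chartA, chartB}" "d \<in> {chartA, chartB}" and q: "q \<in> fst c \<inter> fst d"
      and ij: "i < 2" "j < 2" for c d q i j
  proof (cases "c = d")
    case True
    then show ?thesis
      using q ij by (simp add: sum_less_2 jacobian_same[OF cd(2)]) (auto simp: fold_form_def)
  next
    case False
    from jacobian_flip[OF cd False q] obtain \<sigma> x0 x1 where J: "\<sigma> * \<sigma> = 1" "snd c q = vec2 x0 x1"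
        "x0 \<noteq> 0" "snd d q = vec2 (- 1 / x0) (\<sigma> * x1 / x0)"
    "jacobian c d (\<lambda>x. x) q 0 0 = 1 / x0\<^sup>2" "jacobian c d (\<lambda>x. x) q 0 (Suc 0) = 0"
    "jacobian c d (\<lambda>x. x) q (Suc 0) 0 = - \<sigma> * x1 / x0\<^sup>2"
        "jacobian c d (\<lambda>x. x) q (Suc 0) (Suc 0) = \<sigma> / x0" .
    have *: "1 + (- 1 / x0)\<^sup>2 = (1 + x0\<^sup>2) / x0\<^sup>2"
      using J(3) by (simp add: field_simps power2_eq_square)
    \<comment> \<open>A form of top degree is multiplied by the Jacobian determinant, here the
      product of the diagonal entries because the upper right one vanishes. The sign \<sigma> enters
      once through x1 and once through the determinant, and cancels.\<close>
    have "fold_coeff (snd d q) * (1 / x0\<^sup>2) * (\<sigma> / x0) = (\<sigma> * \<sigma>) * (x1 / (1 + x0\<^sup>2)\<^sup>2)"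
      unfolding J(4) fold_coeff_def vec2_simps One_nat_def *
      using J(3) by (simp add: field_simps power2_eq_square)
    then have 1: "fold_coeff (snd d q) * jacobian c d (\<lambda>x. x) q 0 0 * jacobian c d (\<lambda>x. x) q
          (Suc 0) (Suc 0)
        = fold_coeff (snd c q)"
      by (simp add: J fold_coeff_def)
    consider "i = 0" "j = 0" | "i = 0" "j = Suc 0" | "i = Suc 0" "j = 0" | "i = Suc 0" "j = Suc 0"
      using ij by linarith
    then show ?thesis
      by cases (simp_all add: sum_less_2 fold_form_def J(6) 1[symmetric] mult_ac)
  qed
  show ?thesis
    unfolding smooth_two_form_def moebius_mfd_simps
  proof (intro conjI ballI allI impI)
    show "smooth_on 2 (snd c ` fst c) (\<lambda>x. fold_form c (chart_inv c x) i j)"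
      if "c \<in> {chartA, chartB}" for c i j
      using A[OF that] chart_range[OF that] by simp
  qed (rule B C; assumption)+
qed

lemma smooth_rot_field: "smooth_vector_field moebius_mfd rot_field"
proof -
  have A: "smooth_on 2 (coord_space 2) (\<lambda>x. rot_field c (chart_inv c x) i)"
    if c: "c \<in> {chartA, chartB}" and "i < 2" for c i
  proof (rule rational_imp_smooth_on)
    show "rational_on (coord_space 2) (\<lambda>x. if i = 0 then - 2 * (1 + (x 0)\<^sup>2) else - 2 * x 0 * x 1)"
      by (intro rational_if rational_intros)
    show "openin (Euclidean_space 2) (coord_space 2)" by simp
  qed (use chart_of_inv[OF c] \<open>i < 2\<close> in \<open>auto simp: rot_field_def vec2_def\<close>)
  have B: "rot_field d q i = (\<Sum>j<2. jacobian c d (\<lambda>x. x) q i j * rot_field c q j)"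
    if cd: "c \<in> {chartA, chartB}" "d \<in> {chartA, chartB}" and q: "q \<in> fst c \<inter> fst d" and i: "i < 2"
        for c d q i
  proof (cases "c = d")
    case True
    then show ?thesis
      using q i less_2_cases[OF i] by (auto simp: sum_less_2 jacobian_same[OF cd(2)])
  next
    case False
    from jacobian_flip[OF cd False q] obtain \<sigma> x0 x1 where J: "\<sigma> * \<sigma> = 1" "snd c q = vec2 x0 x1"
        "x0 \<noteq> 0" "snd d q = vec2 (- 1 / x0) (\<sigma> * x1 / x0)"
    "jacobian c d (\<lambda>x. x) q 0 0 = 1 / x0\<^sup>2" "jacobian c d (\<lambda>x. x) q 0 (Suc 0) = 0"
    "jacobian c d (\<lambda>x. x) q (Suc 0) 0 = - \<sigma> * x1 / x0\<^sup>2"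
        "jacobian c d (\<lambda>x. x) q (Suc 0) (Suc 0) = \<sigma> / x0" .
    consider "i = 0" | "i = Suc 0"
      using i by linarith
    then show ?thesis
    proof cases
      case 1
      then show ?thesis
        using J(3) by (simp add: sum_less_2 J(2,4-6) rot_field_def)
          (simp add: field_simps power2_eq_square)
    next
      case 2
      then show ?thesis
        using J(3) by (simp add: sum_less_2 J(2,4,7,8) rot_field_def)
          (simp add: field_simps power2_eq_square)
    qed
  qed
  show ?thesis
    unfolding smooth_vector_field_def moebius_mfd_simps
  proof (intro conjI ballI allI impI)
    show "smooth_on 2 (snd c ` fst c) (\<lambda>x. rot_field c (chart_inv c x) i)"
      if "c \<in> {chartA, chartB}" "i < 2" for c i
      using A[OF that] chart_range[OF that(1)] by simp
  qed (rule B; assumption)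
qed

section \<open>The folded integrable system\<close>

lemma add_mult_self_nonzero [simp]: "1 + x * x \<noteq> (0::real)"
  using add_square_nonzero[of x] by (simp add: power2_eq_square)

lemma square_neq_minus_one [simp]: "x\<^sup>2 \<noteq> (- 1::real)"
  using add_square_nonzero[of x] by linarith

section \<open>The folding hypersurface and the symplectic conditions\<close>

lemma chart_partial_eqI:
  assumes c: "c \<in> {chartA, chartB}" "q \<in> fst c" and "i < 2"
    and g: "\<And>x. x \<in> coord_space 2 \<Longrightarrow> g (chart_inv c x) = G x"
    and D: "((\<lambda>t. G ((snd c q)(i := t))) has_real_derivative D) (at (snd c q i))"
  shows "chart_partial c i g q = D"
  unfolding chart_partial_def
  by (rule partial_eqI[OF D, where S="coord_space 2" and m=2])
    (use snd_chart_in[OF c] \<open>i < 2\<close> g in auto)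

lemma top_power_1: "top_power 1 B = (B 0 1 - B 1 0) / 2"
proof -
  have "{..<2 * 1} = {0, 1 :: nat}" by auto
  then have "{\<sigma>. \<sigma> permutes {..<2 * (1::nat)}} = {id, Transposition.transpose 0 1}"
    by (auto simp only: permutes_doubleton_iff)
  moreover have "id \<noteq> Transposition.transpose 0 (1::nat)"
    by (metis id_apply transpose_apply_first zero_neq_one)
  ultimately show ?thesis
    by (simp add: top_power_def sign_swap_id)
qed

lemma top_power_fold_form: "top_power 1 (fold_form c q) = fold_coeff (snd c q)"
  unfolding top_power_1 by (simp add: fold_form_def)

lemma bilinear_fold_form:
  "bilinear_form 2 (fold_form c q) u v = fold_coeff (snd c q) * (u 0 * v (Suc 0) - u (Suc 0) * v 0)"
  by (simp add: bilinear_form_def sum_less_2 fold_form_def algebra_simps)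

lemma fold_coeff_zero_iff: "fold_coeff x = 0 \<longleftrightarrow> x 1 = 0"
  by (simp add: fold_coeff_def)

lemma sq_dist_chart_inv:
  assumes "c \<in> {chartA, chartB}" "x \<in> coord_space 2"
  shows "sq_dist (chart_inv c x) = (x 1)\<^sup>2 / (1 + (x 0)\<^sup>2)"
proof -
  have "(b / D)\<^sup>2 + (m * b / D)\<^sup>2 = b\<^sup>2 / D" "(- (m * b / D))\<^sup>2 + (b / D)\<^sup>2 = b\<^sup>2 / D"
    if "D = 1 + m\<^sup>2" for b m D :: real
  proof -
    have "(b / D)\<^sup>2 + (m * b / D)\<^sup>2 = b\<^sup>2 * D / D\<^sup>2"
      unfolding that by (simp add: power_divide power_mult_distrib add_divide_distrib[symmetric]
          algebra_simps)
    then show "(b / D)\<^sup>2 + (m * b / D)\<^sup>2 = b\<^sup>2 / D"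
      by (simp add: power2_eq_square)
    then show "(- (m * b / D))\<^sup>2 + (b / D)\<^sup>2 = b\<^sup>2 / D"
      by (simp add: add.commute)
  qed
  from this[OF refl, of "x 1" "x 0"] show ?thesis
    by (simp add: chart_inv_eq[OF assms] sq_dist_def pointA_def pointB_def)
qed

lemma sq_dist_chart:
  assumes "c \<in> {chartA, chartB}" "q \<in> fst c"
  shows "sq_dist q = (snd c q 1)\<^sup>2 / (1 + (snd c q 0)\<^sup>2)"
  using sq_dist_chart_inv[OF assms(1) snd_chart_in[OF assms]] inv_of_chart[OF assms] by simp

lemma sq_dist_zero_iff:
  assumes "c \<in> {chartA, chartB}" "q \<in> fst c"
  shows "sq_dist q = 0 \<longleftrightarrow> snd c q 1 = 0"
  by (simp add: sq_dist_chart[OF assms])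

lemma chart_covers: "q \<in> moebius \<Longrightarrow> \<exists>c\<in>{chartA, chartB}. q \<in> fst c"
  by (auto simp: chartA_def chartB_def)

lemma fst_chart_subset: "c \<in> {chartA, chartB} \<Longrightarrow> fst c \<subseteq> moebius"
  by (auto simp: chartA_def chartB_def)

definition core :: "(nat \<Rightarrow> real) set" where
  "core = {q \<in> moebius. sq_dist q = 0}"

lemma folding_hypersurface_moebius: "folding_hypersurface 1 moebius_mfd fold_form = core"
proof (intro equalityI subsetI)
  fix q assume "q \<in> folding_hypersurface 1 moebius_mfd fold_form"
  then obtain c where c: "c \<in> {chartA, chartB}" "q \<in> fst c" "top_power 1 (fold_form c q) = 0"
    unfolding folding_hypersurface_def moebius_mfd_simps by blast
  then show "q \<in> core"
    using fst_chart_subset[OF c(1)] sq_dist_zero_iff[OF c(1,2)]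
    unfolding core_def top_power_fold_form fold_coeff_zero_iff by blast
next
  fix q assume "q \<in> core"
  moreover then obtain c where c: "c \<in> {chartA, chartB}" "q \<in> fst c"
    using chart_covers unfolding core_def by blast
  ultimately show "q \<in> folding_hypersurface 1 moebius_mfd fold_form"
    using sq_dist_zero_iff[OF c]
    unfolding folding_hypersurface_def moebius_mfd_simps core_def top_power_fold_form
        fold_coeff_zero_iff by blast
qed

text \<open>The coefficient is linear in x1, so its derivative across the core is nowhere zero; this
  is transversality.\<close>

lemma partial_fold_coeff:
  assumes c: "c \<in> {chartA, chartB}" "q \<in> fst c"
  shows "chart_partial c (Suc 0) (\<lambda>r. fold_coeff (snd c r)) q = 1 / (1 + (snd c q 0)\<^sup>2)\<^sup>2"
proof (rule chart_partial_eqI[OF c])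
  show "((\<lambda>t. fold_coeff ((snd c q)(Suc 0 := t))) has_real_derivative
      1 / (1 + (snd c q 0)\<^sup>2)\<^sup>2) (at (snd c q (Suc 0)))"
    unfolding fold_coeff_def
    by (auto intro!: derivative_eq_intros) (simp add: frac_eq_eq flip: power_add)
qed (use chart_of_inv[OF c(1)] in auto)

text \<open>No three indices below 2 are distinct, so closedness is a cancellation by antisymmetry.
  The analytic input is that \<open>deriv\<close> commutes with negation, obtained here from
  differentiability.\<close>

lemma partial_minus_fold_coeff:
  assumes c: "c \<in> {chartA, chartB}" "q \<in> fst c" and "i < 2"
  shows "chart_partial c i (\<lambda>r. - fold_coeff (snd c r)) q
           = - chart_partial c i (\<lambda>r. fold_coeff (snd c r)) q"
proof -
  have g: "\<And>x. x \<in> coord_space 2 \<Longrightarrow> fold_coeff (snd c (chart_inv c x)) = fold_coeff x"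
    using chart_of_inv[OF c(1)] by simp
  have "rational_on (coord_space 2) fold_coeff"
    unfolding fold_coeff_def by (intro rational_intros) auto
  then obtain D where D: "((\<lambda>t. fold_coeff ((snd c q)(i := t))) has_real_derivative D)
      (at (snd c q i))"
    using rational_on_partial[of "coord_space 2" fold_coeff i] snd_chart_in[OF c] by blast
  have "chart_partial c i (\<lambda>r. fold_coeff (snd c r)) q = D"
    by (rule chart_partial_eqI[OF c \<open>i < 2\<close> g D])
  moreover have "chart_partial c i (\<lambda>r. - fold_coeff (snd c r)) q = - D"
    by (rule chart_partial_eqI[OF c \<open>i < 2\<close> _ DERIV_minus[OF D]]) (use g in auto)
  ultimately show ?thesis
    by simp
qed

lemma partial_const: "chart_partial c i (\<lambda>r. a) q = 0"
  by (simp add: chart_partial_def partial_def)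

lemma folded_symplectic_moebius: "folded_symplectic_manifold 1 moebius_mfd fold_form"
proof -
  have "closed_two_form moebius_mfd fold_form"
    unfolding closed_two_form_def moebius_mfd_simps
  proof (intro ballI allI impI)
    fix c q and i j k :: nat
    assume c: "c \<in> {chartA, chartB}" "q \<in> fst c" and "i < 2" "j < 2" "k < 2"
    then have "(i = 0 \<or> i = Suc 0) \<and> (j = 0 \<or> j = Suc 0) \<and> (k = 0 \<or> k = Suc 0)"
      by linarith
    then show "chart_partial c i (\<lambda>r. fold_form c r j k) q +
        chart_partial c j (\<lambda>r. fold_form c r k i) q +
        chart_partial c k (\<lambda>r. fold_form c r i j) q = 0"
      by (elim conjE disjE; simp add: fold_form_def partial_const partial_minus_fold_coeff[OF c])
  qed
  moreover have "transverse_top_power 1 moebius_mfd fold_form"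
    unfolding transverse_top_power_def top_power_fold_form moebius_mfd_simps
  proof (intro ballI impI exI[of _ "Suc 0"] conjI)
    fix c q assume "c \<in> {chartA, chartB}" "q \<in> fst c"
    then show "chart_partial c (Suc 0) (\<lambda>r. fold_coeff (snd c r)) q \<noteq> 0"
      by (simp add: partial_fold_coeff del: insert_iff)
  qed simp
  moreover have "rank_on W (bilinear_form 2 (fold_form c q)) = 0"
    if "c \<in> {chartA, chartB}" "q \<in> fst c \<inter> core" for c q W
  proof -
    have "fold_coeff (snd c q) = 0"
      using that sq_dist_zero_iff[OF that(1)] unfolding core_def fold_coeff_zero_iff by blast
    then have B: "bilinear_form 2 (fold_form c q) u v = 0" for u v
      by (simp add: bilinear_fold_form)
    \<comment> \<open>Where the form is zero, every coefficient vector satisfies the linear relation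
      in \<open>rank_on\<close>; the constant vector 1 then excludes any positive
      \<open>k\<close>.\<close>
    have "k = 0" if "\<forall>a :: nat \<Rightarrow> real. \<forall>i<k. a i = 0" for k :: nat
      using spec[OF that, of "\<lambda>_. 1"] by auto
    then show ?thesis
      unfolding rank_on_def B by (intro Greatest_equality) auto
  qed
  ultimately show ?thesis
    unfolding folded_symplectic_manifold_def folding_hypersurface_moebius
    using smooth_manifold_moebius smooth_two_form_fold_form by simp
qed

section \<open>The Hamiltonian vector field of the squared distance\<close>

lemma partials_sq_dist:
  assumes c: "c \<in> {chartA, chartB}" "q \<in> fst c"
  shows "chart_partial c 0 sq_dist q = - 2 * snd c q 0 * (snd c q 1)\<^sup>2 / (1 + (snd c q 0)\<^sup>2)\<^sup>2"
    and "chart_partial c (Suc 0) sq_dist q = 2 * snd c q 1 / (1 + (snd c q 0)\<^sup>2)"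
proof -
  have D0: "((\<lambda>t. (((snd c q)(0 := t)) 1)\<^sup>2 / (1 + (((snd c q)(0 := t)) 0)\<^sup>2)) has_real_derivative
      - 2 * snd c q 0 * (snd c q 1)\<^sup>2 / (1 + (snd c q 0)\<^sup>2)\<^sup>2) (at (snd c q 0))"
    by (auto intro!: derivative_eq_intros simp: power2_eq_square)
  have D1: "((\<lambda>t. (((snd c q)(Suc 0 := t)) 1)\<^sup>2 / (1 +
      (((snd c q)(Suc 0 := t)) 0)\<^sup>2)) has_real_derivative
      2 * snd c q 1 / (1 + (snd c q 0)\<^sup>2)) (at (snd c q (Suc 0)))"
    by (auto intro!: derivative_eq_intros)
  show "chart_partial c 0 sq_dist q = - 2 * snd c q 0 * (snd c q 1)\<^sup>2 / (1 + (snd c q 0)\<^sup>2)\<^sup>2"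
    by (rule chart_partial_eqI[OF c _ sq_dist_chart_inv[OF c(1)] D0]) auto
  show "chart_partial c (Suc 0) sq_dist q = 2 * snd c q 1 / (1 + (snd c q 0)\<^sup>2)"
    by (rule chart_partial_eqI[OF c _ sq_dist_chart_inv[OF c(1)] D1]) auto
qed

text \<open>The right-hand side is arranged as minus the form applied to \<open>rot_field\<close>
  and \<open>v\<close>. It thus gives the Hamiltonian equation, and the factor
  \<open>fold_coeff\<close> shows that the differential vanishes on the core.\<close>

lemma differential_sq_dist:
  assumes c: "c \<in> {chartA, chartB}" "q \<in> fst c"
  shows "differential 2 c sq_dist q v =
    - fold_coeff (snd c q) * (rot_field c q 0 * v (Suc 0) - rot_field c q (Suc 0) * v 0)"
proof -
  have "- 2 * m * b\<^sup>2 / D\<^sup>2 * v0 + 2 * b / D * v1 = - (b / D\<^sup>2) * (- 2 * D * v1 - - 2 * m * b * v0)"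
    if "D \<noteq> 0" for b D m v0 v1 :: real
    using that by (simp add: field_simps power2_eq_square)
  from this[OF add_square_nonzero] show ?thesis
    unfolding differential_def sum_less_2 partials_sq_dist[OF c] fold_coeff_def rot_field_def
        vec2_simps One_nat_def .
qed

lemma is_hamiltonian_rot_field:
  "is_hamiltonian_vector_field moebius_mfd fold_form sq_dist rot_field"
  unfolding is_hamiltonian_vector_field_def moebius_mfd_simps
  using smooth_rot_field differential_sq_dist by (auto simp: bilinear_fold_form)

lemma smooth_field_continuous:
  assumes "smooth_vector_field moebius_mfd X" "c \<in> {chartA, chartB}" "i < 2"
  shows "continuous_on (coord_space 2) (\<lambda>x. X c (chart_inv c x) i)"
proof -
  have "smooth_on 2 (coord_space 2) (\<lambda>x. X c (chart_inv c x) i)"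
    using assms unfolding smooth_vector_field_def moebius_mfd_simps
        chart_range[OF assms(2), symmetric] by blast
  then have "C_on 2 0 (coord_space 2) (\<lambda>x. X c (chart_inv c x) i)"
    unfolding smooth_on_def by blast
  then show ?thesis
    by (simp add: Euclidean_space_top_of_set subtopology_subtopology)
qed

text \<open>The form determines the field off the core; continuity extends the equality across it.\<close>

lemma hamiltonian_unique:
  assumes X: "is_hamiltonian_vector_field moebius_mfd fold_form sq_dist X"
    and c: "c \<in> {chartA, chartB}" and q: "q \<in> fst c" and i: "i < 2"
  shows "X c q i = rot_field c q i"
proof -
  have off: "X c r i = rot_field c r i" if r: "r \<in> fst c" "snd c r 1 \<noteq> 0" for r
  proof -
    have "fold_coeff (snd c r) * (X c r 0 * v (Suc 0) - X c r (Suc 0) * v 0) =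
      fold_coeff (snd c r) * (rot_field c r 0 * v (Suc 0) - rot_field c r (Suc 0) * v 0)"
      if "v \<in> coord_space 2" for v
    proof -
      have "bilinear_form 2 (fold_form c r) (X c r) v = - differential 2 c sq_dist r v"
        using X c r(1) that unfolding is_hamiltonian_vector_field_def moebius_mfd_simps by blast
      then show ?thesis
        by (simp add: bilinear_fold_form differential_sq_dist[OF c r(1)])
    qed
    then have *: "X c r 0 * v (Suc 0) - X c r (Suc 0) * v 0 = rot_field c r 0 * v (Suc 0) -
        rot_field c r (Suc 0) * v 0"
      if "v \<in> coord_space 2" for v
      using r(2) that fold_coeff_zero_iff by simp
    show ?thesis
      using *[of "vec2 0 1"] *[of "vec2 1 0"] less_2_cases[OF i] by auto
  qed
  define x0 where "x0 = snd c q 0"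
  define h where "h t = X c (chart_inv c (vec2 x0 t)) i - rot_field c (chart_inv c (vec2 x0 t)) i"
      for t
  have con: "continuous_on UNIV (\<lambda>t. Y c (chart_inv c (vec2 x0 t)) i)"
    if "smooth_vector_field moebius_mfd Y" for Y
    by (rule continuous_on_compose2[OF smooth_field_continuous[OF that c i]])
      (auto intro: continuous_intros)
  have "continuous_on (closure (- {0})) h"
    unfolding h_def using X
    by (intro continuous_on_diff continuous_on_subset[OF con] smooth_rot_field)
      (auto simp: is_hamiltonian_vector_field_def)
  moreover have "h t = 0" if "t \<in> - {0}" for t
    using off[of "chart_inv c (vec2 x0 t)"] that chart_inv_in[OF c] chart_of_inv[OF c]
        by (simp add: h_def)
  moreover have "snd c q 1 \<in> closure (- {0 :: real})"
    by (simp add: closure_complement)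
  ultimately have "h (snd c q 1) = 0"
    by (rule continuous_constant_on_closure)
  moreover have "chart_inv c (vec2 x0 (snd c q 1)) = q"
    using vec2_collapse[OF snd_chart_in[OF c q]] inv_of_chart[OF c q] by (simp add: x0_def)
  ultimately show ?thesis
    by (simp add: h_def)
qed

text \<open>The field is a \<open>SOME\<close> term: \<open>rot_field\<close> witnesses existence,
  and uniqueness fixes the components in the atlas charts and for genuine indices, which are the
  only ones determined.\<close>

lemma hamiltonian_vector_field_moebius:
  assumes "c \<in> {chartA, chartB}" "q \<in> fst c" "i < 2"
  shows "hamiltonian_vector_field moebius_mfd fold_form sq_dist c q i = rot_field c q i"
  unfolding hamiltonian_vector_field_def
  by (rule hamiltonian_unique[OF someI[where P =
      "is_hamiltonian_vector_field moebius_mfd fold_form sq_dist", OF is_hamiltonian_rot_field] assms])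

text \<open>Rotation has no fixed lines, not even on the core, where the differential of the
  function itself is zero; hence every point is regular.\<close>

lemma rot_field_nonzero: "rot_field c q 0 \<noteq> 0"
  by (simp add: rot_field_def)

lemma regular_point_moebius: "q \<in> moebius \<Longrightarrow> regular_point 1 moebius_mfd fold_form (\<lambda>_. sq_dist) q"
  unfolding regular_point_def moebius_mfd_simps
  by (auto simp: less_2_cases_All hamiltonian_vector_field_moebius rot_field_nonzero)

lemma folded_integrable_moebius: "folded_integrable_system 1 moebius_mfd fold_form (\<lambda>_. sq_dist)"
proof -
  have "smooth_on 2 (coord_space 2) (\<lambda>x. sq_dist (chart_inv c x))" if c: "c \<in> {chartA, chartB}"
      for c
  proof (rule rational_imp_smooth_on[OF _ _ sq_dist_chart_inv[OF c]])
    show "rational_on (coord_space 2) (\<lambda>x. (x 1)\<^sup>2 / (1 + (x 0)\<^sup>2))"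
      by (intro rational_intros) auto
    show "openin (Euclidean_space 2) (coord_space 2)" by simp
  qed
  then have "smooth_function moebius_mfd sq_dist"
    unfolding smooth_function_def moebius_mfd_simps using chart_range by simp
  moreover have "differential 2 c sq_dist q v = 0" if "c \<in> {chartA, chartB}" "q \<in> fst c \<inter> core"
      for c q v
    using that sq_dist_zero_iff[of c q] by (auto simp: differential_sq_dist core_def fold_coeff_def)
  ultimately have "folded_function 1 moebius_mfd fold_form sq_dist"
    unfolding folded_function_def folding_hypersurface_moebius moebius_mfd_simps by blast
  moreover have "points moebius_mfd \<subseteq> mtop moebius_mfd closure_of
      {q. regular_point 1 moebius_mfd fold_form (\<lambda>_. sq_dist) q}"
    using regular_point_moebius closure_of_subset_Int[of "mtop moebius_mfd"
        "{q. regular_point 1 moebius_mfd fold_form (\<lambda>_. sq_dist) q}"]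
    unfolding moebius_mfd_simps topspace_euclidean_subtopology by blast
  moreover have "core \<subseteq> mtop moebius_mfd closure_of
      {q \<in> core. regular_point 1 moebius_mfd fold_form (\<lambda>_. sq_dist) q}"
  proof -
    have "core \<subseteq> moebius"
      by (auto simp: core_def)
    then have "{q \<in> core. regular_point 1 moebius_mfd fold_form (\<lambda>_. sq_dist) q} = core"
      using regular_point_moebius by blast
    then show ?thesis
      using closure_of_subset[of core "mtop moebius_mfd"] \<open>core \<subseteq> moebius\<close> by simp
  qed
  moreover have "bilinear_form 2 (fold_form c q) u u = 0" for c q u
    by (simp add: bilinear_fold_form)
  ultimately show ?thesis
    unfolding folded_integrable_system_def folding_hypersurface_moebius by auto
qed

section \<open>The leaf through a point of the core\<close>

lemma is_chart_inv:
  assumes "is_chart m T c" "q \<in> fst c"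
  shows "chart_inv c (snd c q) = q"
proof -
  have "topspace (subtopology T (fst c)) = fst c"
    using assms(1) openin_subset[of T "fst c"] by (auto simp: is_chart_def)
  then have "inj_on (snd c) (fst c)"
    using assms(1) homeomorphic_imp_injective_map unfolding is_chart_def embedding_map_def by metis
  then show ?thesis
    using assms(2) by (simp add: chart_inv_def)
qed

lemma continuous_on_sq_dist: "continuous_on S sq_dist"
  unfolding sq_dist_def by (intro continuous_intros continuous_on_coord)

text \<open>Tangent vectors of the integral manifold are multiples of \<open>rot_field\<close>, and
  z^2 is invariant under rotation.\<close>

lemma integral_manifold_sq_dist_derivative:
  assumes N: "integral_manifold 1 moebius_mfd fold_form (\<lambda>_. sq_dist) U N"
    and b: "b \<in> matlas N" "q \<in> fst b"
  shows "((\<lambda>t. sq_dist (chart_inv b ((snd b q)(0 := t)))) has_real_derivative 0) (at (snd b q 0))"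
proof -
  have chart: "is_chart 1 (mtop N) b" and "\<Union> (fst ` matlas N) = points N"
    and sm: "smooth_map_on N (points N) moebius_mfd (\<lambda>x. x)" and dim: "mdim N = 1"
    and cont: "continuous_map (mtop N) (top_of_set moebius) (\<lambda>x. x)"
    using N b(1) by (auto simp: integral_manifold_def smooth_manifold_def smooth_map_on_def)
  then have qN: "q \<in> points N" using b by blast
  then have "q \<in> moebius"
    using continuous_map_image_subset_topspace[OF cont] by auto
  then obtain c where c: "c \<in> {chartA, chartB}" "q \<in> fst c"
    using chart_covers by blast
  define S where "S = snd b ` (fst b \<inter> points N \<inter> (\<lambda>x. x) -` fst c)"
  \<comment> \<open>The topology of \<open>N\<close> may be finer than the subspace topology, so
    openness of the overlap in \<open>N\<close> is drawn from continuity of the inclusion.\<close>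
  have "openin (top_of_set moebius) (fst c)"
    using c(1) openin_fst_chart by auto
  then have "openin (mtop N) {x \<in> points N. x \<in> fst c}"
    using openin_continuous_map_preimage[OF cont] by simp
  then have "openin (Euclidean_space 1) (snd b ` (fst b \<inter> {x \<in> points N. x \<in> fst c}))"
    by (rule is_chart_image_openin[OF chart])
  moreover have "fst b \<inter> {x \<in> points N. x \<in> fst c} = fst b \<inter> points N \<inter> (\<lambda>x. x) -` fst c"
    by auto
  ultimately have S: "openin (Euclidean_space 1) S"
    by (simp add: S_def)
  have xS: "snd b q \<in> S"
    unfolding S_def using b(2) qN c(2) by auto
  have in_c: "chart_inv b y \<in> fst c" if "y \<in> S" for y
    using that is_chart_inv[OF chart] unfolding S_def by auto
  have J: "((\<lambda>t. snd c (chart_inv b ((snd b q)(0 := t))) i) has_real_derivative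
      jacobian b c (\<lambda>x. x) q i 0)
      (at (snd b q 0))" if "i < 2" for i
  proof -
    have "smooth_on 1 S (\<lambda>x. snd c (chart_inv b x) i)"
      using sm b(1) c(1) that unfolding smooth_map_on_def moebius_mfd_simps dim S_def by blast
    then have "C_on 1 (Suc 0) S (\<lambda>x. snd c (chart_inv b x) i)"
      unfolding smooth_on_def by blast
    then have "(\<lambda>t. snd c (chart_inv b ((snd b q)(0 := t))) i) differentiable at (snd b q 0)"
      using xS by simp
    then show ?thesis
      unfolding jacobian_def partial_def by (simp add: DERIV_deriv_iff_real_differentiable)
  qed
  let ?j = "jacobian b c (\<lambda>x. x) q"
  \<comment> \<open>The unit vector \<open>vec2 1 0\<close>, which lies in
    \<open>coord_space 1\<close>, maps to the only column of the Jacobian. The tangency condition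
    makes this column a multiple of \<open>rot_field\<close>.\<close>
  have "vec2 (?j 0 0) (?j 1 0) \<in> {w \<in> coord_space 2. \<exists>v\<in>coord_space 1. \<forall>i<2.
      w i = (\<Sum>j<1. ?j i j * v j)}"
    by (auto simp: less_2_cases_All intro!: bexI[of _ "vec2 1 0"])
      (simp add: coord_space_iff vec2_def)
  also have "\<dots> = {w \<in> coord_space 2. \<exists>a :: nat \<Rightarrow> real. \<forall>i<2. w i =
      (\<Sum>k<1. a k * hamiltonian_vector_field moebius_mfd fold_form sq_dist c q i)}"
    using N b c unfolding integral_manifold_def moebius_mfd_simps by blast
  finally obtain a :: real where a: "?j 0 0 = a * rot_field c q 0"
      "?j (Suc 0) 0 = a * rot_field c q (Suc 0)"
    using hamiltonian_vector_field_moebius[OF c] by (auto simp: less_2_cases_All)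
  define y where "y = snd c q"
  have q: "chart_inv b (snd b q) = q"
    using is_chart_inv[OF chart b(2)] .
  show ?thesis
  proof (rule upd_derivative_transfer[OF _ S xS])
    show "((\<lambda>t. (snd c (chart_inv b ((snd b q)(0 := t))) 1)\<^sup>2 / (1 +
        (snd c (chart_inv b ((snd b q)(0 := t))) 0)\<^sup>2))
      has_real_derivative 0) (at (snd b q 0))"
      using J[of 0] J[of 1] unfolding One_nat_def a rot_field_def vec2_simps
      by (auto intro!: derivative_eq_intros simp: q algebra_simps power2_eq_square)
    show "sq_dist (chart_inv b y) = (snd c (chart_inv b y) 1)\<^sup>2 / (1 +
        (snd c (chart_inv b y) 0)\<^sup>2)" if "y \<in> S" for y
      by (rule sq_dist_chart[OF c(1) in_c[OF that]])
  qed simp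
qed

text \<open>In a chart of \<open>N\<close> the derivative vanishes on a whole interval around the
  image of \<open>q\<close>, so the function is constant there, with its value at
  \<open>q\<close>.\<close>

lemma integral_manifold_sq_dist_locally_zero:
  assumes N: "integral_manifold 1 moebius_mfd fold_form (\<lambda>_. sq_dist) U N"
    and q: "q \<in> points N" "sq_dist q = 0"
  shows "\<exists>V. openin (mtop N) V \<and> q \<in> V \<and> (\<forall>r\<in>V. sq_dist r = 0)"
proof -
  have "\<Union> (fst ` matlas N) = points N"
    using N by (auto simp: integral_manifold_def smooth_manifold_def)
  then obtain b where b: "b \<in> matlas N" "q \<in> fst b"
    using q(1) by blast
  have chart: "is_chart 1 (mtop N) b"
    using N b(1) by (auto simp: integral_manifold_def smooth_manifold_def)
  define x where "x = snd b q"
  have op: "openin (Euclidean_space 1) (snd b ` fst b)"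
    using chart by (simp add: is_chart_def)
  have "x \<in> snd b ` fst b"
    using b(2) by (simp add: x_def)
  then have "\<forall>\<^sub>F t in nhds (x 0). x(0 := t) \<in> snd b ` fst b"
    using eventually_upd_in_openin[OF op, of x 0] by simp
  then obtain d where d: "d > 0" "\<And>t. dist t (x 0) < d \<Longrightarrow> x(0 := t) \<in> snd b ` fst b"
    unfolding eventually_nhds_metric by blast
  have "((\<lambda>t. sq_dist (chart_inv b (x(0 := t)))) has_real_derivative 0) (at t within ball (x 0) d)"
    if t: "t \<in> ball (x 0) d" for t
  proof -
    obtain r where r: "r \<in> fst b" "snd b r = x(0 := t)"
      using d(2)[of t] t by (auto simp: dist_commute)
    from integral_manifold_sq_dist_derivative[OF N b(1) r(1)] show ?thesis
      unfolding r(2) by (simp add: has_field_derivative_at_within)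
  qed
  then obtain k where k: "\<And>t. t \<in> ball (x 0) d \<Longrightarrow> sq_dist (chart_inv b (x(0 := t))) = k"
    using has_field_derivative_zero_constant[OF convex_ball] by metis
  have "k = 0"
    using k[of "x 0"] d(1) q(2) is_chart_inv[OF chart b(2)] by (simp add: x_def)
  define T where "T = coord_space 1 \<inter> {y. y 0 \<in> ball (x 0) d}"
  have "open ((\<lambda>y :: nat \<Rightarrow> real. y 0) -` ball (x 0) d)"
    by (intro open_vimage continuous_on_coord open_ball)
  then have T: "openin (Euclidean_space 1) T"
    by (auto simp: Euclidean_space_top_of_set T_def vimage_def openin_open)
  have fb: "openin (mtop N) (fst b)" "topspace (subtopology (mtop N) (fst b)) = fst b"
    using chart openin_subset[of "mtop N" "fst b"] by (auto simp: is_chart_def)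
  have "continuous_map (subtopology (mtop N) (fst b)) (Euclidean_space 1) (snd b)"
    using chart unfolding is_chart_def embedding_map_def
    by (blast dest: homeomorphic_imp_continuous_map continuous_map_into_fulltopology)
  then have "openin (subtopology (mtop N) (fst b)) {r \<in> fst b. snd b r \<in> T}"
    using openin_continuous_map_preimage[OF _ T, of "subtopology (mtop N) (fst b)" "snd b"]
    unfolding fb(2) by blast
  then have "openin (mtop N) {r \<in> fst b. snd b r \<in> T}"
    using fb(1) openin_trans_full by blast
  moreover have "q \<in> {r \<in> fst b. snd b r \<in> T}"
    using b(2) d(1) openin_subset[OF op] by (auto simp: T_def x_def)
  moreover have "sq_dist r = 0" if "r \<in> {r \<in> fst b. snd b r \<in> T}" for r
  proof -
    have "x \<in> coord_space 1" "snd b r \<in> coord_space 1"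
      using b(2) that openin_subset[OF op] by (auto simp: x_def)
    then have "snd b r = x(0 := snd b r 0)"
      by (auto simp: coord_space_iff fun_eq_iff)
    moreover have "snd b r 0 \<in> ball (x 0) d"
      using that by (simp add: T_def)
    ultimately show ?thesis
      using k[of "snd b r 0"] \<open>k = 0\<close> is_chart_inv[OF chart, of r] that by auto
  qed
  ultimately show ?thesis
    by blast
qed

text \<open>In the connected \<open>N\<close> the zero set of \<open>sq_dist\<close> is closed by
  continuity, open by the preceding local statement, and contains \<open>p\<close>.\<close>

lemma integral_manifold_in_core:
  assumes N: "integral_manifold 1 moebius_mfd fold_form (\<lambda>_. sq_dist) U N"
    and p: "p \<in> points N" "sq_dist p = 0"
  shows "points N \<subseteq> core"
proof -
  have conn: "connected_space (mtop N)"
    and cont: "continuous_map (mtop N) (top_of_set moebius) (\<lambda>x. x)"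
    using N by (auto simp: integral_manifold_def smooth_map_on_def)
  have "continuous_map (top_of_set moebius) euclideanreal sq_dist"
    using continuous_on_sq_dist by simp
  then have "continuous_map (mtop N) euclideanreal sq_dist"
    using continuous_map_compose[OF cont, of euclideanreal sq_dist] by (simp add: o_def)
  then have "closedin (mtop N) {q \<in> points N. sq_dist q \<in> {0}}"
    by (rule closedin_continuous_map_preimage) simp
  moreover have "openin (mtop N) {q \<in> points N. sq_dist q \<in> {0}}"
  proof (subst openin_subopen, intro ballI)
    fix q assume "q \<in> {q \<in> points N. sq_dist q \<in> {0}}"
    then obtain V where V: "openin (mtop N) V" "q \<in> V" "\<forall>r\<in>V. sq_dist r = 0"
      using integral_manifold_sq_dist_locally_zero[OF N] by auto
    then have "V \<subseteq> {q \<in> points N. sq_dist q \<in> {0}}"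
      using openin_subset[OF V(1)] by auto
    with V show "\<exists>T. openin (mtop N) T \<and> q \<in> T \<and> T \<subseteq> {q \<in> points N. sq_dist q \<in> {0}}"
      by blast
  qed
  ultimately have "{q \<in> points N. sq_dist q \<in> {0}} = points N"
    using conn p unfolding connected_space_clopen_in by blast
  moreover have "points N \<subseteq> moebius"
    using continuous_map_image_subset_topspace[OF cont] by simp
  ultimately show ?thesis
    by (auto simp: core_def)
qed

text \<open>Each transition preserves the axis x1 = 0, as the lower left entry is a multiple of x1.
  The tangent line of the core is therefore the first coordinate axis in both charts.\<close>

lemma core_jacobian:
  assumes "c \<in> {chartA, chartB}" "d \<in> {chartA, chartB}" "q \<in> fst c \<inter> fst d" "q \<in> core"
  shows "jacobian c d (\<lambda>x. x) q 0 0 \<noteq> 0" "jacobian c d (\<lambda>x. x) q (Suc 0) 0 = 0"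
proof -
  have x: "snd c q (Suc 0) = 0"
    using sq_dist_zero_iff[of c q] assms by (auto simp: core_def)
  have "jacobian c d (\<lambda>x. x) q 0 0 \<noteq> 0 \<and> jacobian c d (\<lambda>x. x) q (Suc 0) 0 = 0"
  proof (cases "c = d")
    case True
    then show ?thesis
      using assms(3) by (simp add: jacobian_same[OF assms(2)])
  next
    case False
    from jacobian_flip[OF assms(1,2) False assms(3)] obtain \<sigma> x0 x1 where
      J: "snd c q = vec2 x0 x1" "x0 \<noteq> 0" "jacobian c d (\<lambda>x. x) q 0 0 = 1 / x0\<^sup>2"
        "jacobian c d (\<lambda>x. x) q (Suc 0) 0 = - \<sigma> * x1 / x0\<^sup>2"
      by metis
    then show ?thesis
      using x by simp
  qed
  then show "jacobian c d (\<lambda>x. x) q 0 0 \<noteq> 0" "jacobian c d (\<lambda>x. x) q (Suc 0) 0 = 0"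
    by auto
qed

section \<open>Arcs of the core as integral manifolds\<close>

definition core_arc :: "(nat \<Rightarrow> real) chart \<Rightarrow> (nat \<Rightarrow> real) manifold" where
  "core_arc c = \<lparr>mdim = 1, mtop = top_of_set (core \<inter> fst c), matlas = {(core \<inter> fst c, snd c)}\<rparr>"

lemma core_arc_simps [simp]: "mdim (core_arc c) = 1" "mtop (core_arc c) = top_of_set (core \<inter> fst c)"
  "matlas (core_arc c) = {(core \<inter> fst c, snd c)}" "points (core_arc c) = core \<inter> fst c"
  by (simp_all add: core_arc_def)

lemma coord_space_mono: "x \<in> coord_space m \<Longrightarrow> m \<le> n \<Longrightarrow> x \<in> coord_space n"
  by (auto simp: coord_space_iff)

lemma continuous_chart_inv:
  assumes "c \<in> {chartA, chartB}"
  shows "continuous_on (coord_space 2) (chart_inv c)"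
proof -
  have "continuous_on (coord_space 2) (\<lambda>x. if c = chartA then pointA x else pointB x)"
    using continuous_pointA continuous_pointB by (cases "c = chartA") auto
  then show ?thesis
    using chart_inv_eq[OF assms] by (simp cong: continuous_on_cong)
qed

text \<open>The arc is the axis x1 = 0 of the chart. Its chart has a smaller domain, so
  \<open>chart_inv\<close> becomes a different term; the last claim permits computing with the
  inverse of \<open>c\<close> instead.\<close>

lemma core_arc_chart:
  assumes c: "c \<in> {chartA, chartB}"
  shows "is_chart 1 (top_of_set (core \<inter> fst c)) (core \<inter> fst c, snd c)"
    and "snd c ` (core \<inter> fst c) = coord_space 1"
    and "\<And>x. x \<in> coord_space 1 \<Longrightarrow> chart_inv (core \<inter> fst c, snd c) x = chart_inv c x"
proof -
  have k1: "snd c q \<in> coord_space 1" if "q \<in> core \<inter> fst c" for q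
  proof -
    have "snd c q 1 = 0"
      using that sq_dist_zero_iff[OF c] by (auto simp: core_def)
    moreover have "snd c q i = 0" if "i \<ge> 2" for i
      using snd_chart_in[OF c] \<open>q \<in> core \<inter> fst c\<close> that by (auto simp: coord_space_iff)
    ultimately show ?thesis
      unfolding coord_space_iff by (metis Suc_1 One_nat_def not_less_eq_eq le_antisym)
  qed
  have e1: "chart_inv c x \<in> core \<inter> fst c" if x: "x \<in> coord_space 1" for x
  proof -
    have x2: "x \<in> coord_space 2" "x 1 = 0"
      using coord_space_mono[OF x, of 2] x by (auto simp: coord_space_iff)
    then show ?thesis
      using chart_inv_in[OF c x2(1)] fst_chart_subset[OF c] sq_dist_chart_inv[OF c x2(1)]
          by (auto simp: core_def)
  qed
  have "continuous_on (core \<inter> fst c) (snd c)"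
    using c continuous_chart continuous_on_subset[of "fst c" "snd c" "core \<inter> fst c"] by auto
  then have k: "continuous_map (subtopology (top_of_set (core \<inter> fst c)) (core \<inter> fst c))
      (Euclidean_space 1) (snd c)"
    using k1 by (auto simp: subtopology_subtopology continuous_map_Euclidean_space_iff)
  have "coord_space 1 \<subseteq> coord_space 2"
    using coord_space_mono by fastforce
  then have "continuous_on (coord_space 1) (chart_inv c)"
    using continuous_on_subset[OF continuous_chart_inv[OF c]] by blast
  then have e: "continuous_map (Euclidean_space 1) (subtopology (top_of_set (core \<inter> fst c))
      (core \<inter> fst c)) (chart_inv c)"
    using e1 by (auto simp: subtopology_subtopology continuous_map_Euclidean_space_iff)
  have o: "openin (top_of_set (core \<inter> fst c)) (core \<inter> fst c)"
    by simp
  note C = is_chartI[OF o k e]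
  show "is_chart 1 (top_of_set (core \<inter> fst c)) (core \<inter> fst c, snd c)"
    "snd c ` (core \<inter> fst c) = coord_space 1"
    "\<And>x. x \<in> coord_space 1 \<Longrightarrow> chart_inv (core \<inter> fst c, snd c) x = chart_inv c x"
    by (rule C; use coord_space_mono[of _ 1 2] chart_of_inv[OF c] inv_of_chart[OF c] in auto)+
qed

lemma core_arc_smooth:
  assumes c: "c \<in> {chartA, chartB}"
  shows "smooth_manifold (core_arc c)"
proof -
  have "smooth_on 1 (coord_space 1) (\<lambda>x. snd c (chart_inv (core \<inter> fst c, snd c) x) 0)"
    by (rule rational_imp_smooth_on[OF _ rational_coord[of _ 0]])
      (use core_arc_chart(3)[OF c] coord_space_mono[of _ 1 2] chart_of_inv[OF c] in auto)
  moreover have "Hausdorff_space (top_of_set (core \<inter> fst c))"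
      "second_countable (top_of_set (core \<inter> fst c))"
    by (auto intro!: Hausdorff_space_subtopology second_countable_subtopology
        second_countable_euclidean)
  ultimately show ?thesis
    unfolding smooth_manifold_def using core_arc_chart[OF c] by simp
qed

lemma core_arc_connected:
  assumes c: "c \<in> {chartA, chartB}"
  shows "connected (core \<inter> fst c)"
proof -
  have "coord_space 1 = range (\<lambda>t. vec2 t 0)"
  proof (intro equalityI subsetI)
    fix x assume "x \<in> coord_space 1"
    then have "x = vec2 (x 0) 0"
      by (auto simp: coord_space_iff vec2_def)
    then show "x \<in> range (\<lambda>t. vec2 t 0)"
      by blast
  qed (auto simp: coord_space_iff vec2_def)
  moreover have "core \<inter> fst c = chart_inv c ` coord_space 1"
    unfolding core_arc_chart(2)[OF c, symmetric] image_image
    using inv_of_chart[OF c] by (simp cong: image_cong_simp)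
  ultimately have "core \<inter> fst c = range (\<lambda>t. chart_inv c (vec2 t 0))"
    by auto
  moreover have "continuous_on UNIV (\<lambda>t. chart_inv c (vec2 t 0))"
    by (rule continuous_on_compose2[OF continuous_chart_inv[OF c]]) (auto intro: continuous_intros)
  ultimately show ?thesis
    using connected_continuous_image connected_UNIV by metis
qed

lemma core_arc_integral_manifold:
  assumes c: "c \<in> {chartA, chartB}"
  shows "integral_manifold 1 moebius_mfd fold_form (\<lambda>_. sq_dist) moebius (core_arc c)"
proof -
  let ?b = "(core \<inter> fst c, snd c)"
  have core: "core \<subseteq> moebius"
    by (auto simp: core_def)
  have sm: "smooth_on 1 (snd c ` (core \<inter> fst c \<inter> fst d)) (\<lambda>x. snd d (chart_inv ?b x) i)"
    if d: "d \<in> {chartA, chartB}" and i: "i < 2" for d i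
  proof -
    let ?S = "snd c ` (core \<inter> fst c \<inter> fst d)"
    have "openin (top_of_set (core \<inter> fst c)) (core \<inter> fst c \<inter> fst d)"
      using d openin_fst_chart core by (force simp: openin_open)
    then have op: "openin (Euclidean_space 1) ?S"
      using is_chart_image_openin[OF core_arc_chart(1)[OF c], of "core \<inter> fst c \<inter> fst d"]
          by (simp add: Int_assoc[symmetric])
    have S: "x \<in> coord_space 1" "x \<in> coord_space 2" "x \<in> snd c ` (fst c \<inter> fst d)" if "x \<in> ?S" for x
    proof -
      show "x \<in> coord_space 1" using that core_arc_chart(2)[OF c] by auto
      then show "x \<in> coord_space 2" by (rule coord_space_mono) simp
      show "x \<in> snd c ` (fst c \<inter> fst d)" using that by auto
    qed
    show ?thesis
      using c d
    proof (cases rule: transition_cases)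
      case same
      show ?thesis
        by (rule rational_imp_smooth_on[OF op rational_coord[of _ i]])
          (use S core_arc_chart(3)[OF c] same chart_of_inv[OF c] in auto)
    next
      case (flip \<sigma>)
      have S0: "x 0 \<noteq> 0" if "x \<in> ?S" for x
        using S(3)[OF that] flip(3) by auto
      then have "rational_on ?S (\<lambda>x. if i = 0 then - 1 / x 0 else \<sigma> * x 1 / x 0)"
        by (intro rational_if rational_intros) auto
      then show ?thesis
      proof (rule rational_imp_smooth_on[OF op])
        fix x assume x: "x \<in> ?S"
        have "snd d (chart_inv ?b x) = vec2 (- 1 / x 0) (\<sigma> * x 1 / x 0)"
          using core_arc_chart(3)[OF c S(1)[OF x]] flip(4)[OF S(2)[OF x] S0[OF x]] by simp
        then show "snd d (chart_inv ?b x) i = (if i = 0 then - 1 / x 0 else \<sigma> * x 1 / x 0)"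
          using i by (simp add: vec2_def)
      qed
    qed
  qed
  have jac: "jacobian ?b d (\<lambda>x. x) q i 0 = jacobian c d (\<lambda>x. x) q i 0" if "q \<in> core \<inter> fst c"
      for d q i
  proof -
    have "snd c q \<in> coord_space 1"
      using core_arc_chart(2)[OF c] that by blast
    then have "chart_inv ?b ((snd c q)(0 := t)) = chart_inv c ((snd c q)(0 := t))" for t
      using core_arc_chart(3)[OF c] coord_space_upd[of _ 1 0] by simp
    then show ?thesis
      by (simp add: jacobian_def partial_def)
  qed
  have tangent: "(\<forall>v\<in>coord_space 1. (\<forall>i<2. (\<Sum>j<1. jacobian ?b d (\<lambda>x. x) q i j * v j) = 0) \<longrightarrow>
      (\<forall>j<1. v j = 0)) \<and>
      {w \<in> coord_space 2. \<exists>v\<in>coord_space 1. \<forall>i<2. w i = (\<Sum>j<1. jacobian ?b d (\<lambda>x. x) q i j * v j)} =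
      {w \<in> coord_space 2. \<exists>a :: nat \<Rightarrow> real. \<forall>i<2.
         w i = (\<Sum>k<1. a k * hamiltonian_vector_field moebius_mfd fold_form sq_dist d q i)}"
    if d: "d \<in> {chartA, chartB}" and q: "q \<in> core \<inter> fst c \<inter> fst d" for d q
  proof -
    let ?J = "jacobian c d (\<lambda>x. x) q 0 0"
    have J: "jacobian ?b d (\<lambda>x. x) q 0 0 = ?J" "?J \<noteq> 0" "jacobian ?b d (\<lambda>x. x) q (Suc 0) 0 = 0"
      using core_jacobian[OF c d, of q] jac[of q] q by auto
    have X: "hamiltonian_vector_field moebius_mfd fold_form sq_dist d q 0 = rot_field d q 0"
      "hamiltonian_vector_field moebius_mfd fold_form sq_dist d q (Suc 0) = 0"
      using q hamiltonian_vector_field_moebius[OF d, of q] sq_dist_zero_iff[OF d, of q]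
      by (auto simp: core_def rot_field_def)
    \<comment> \<open>Both \<open>?J\<close> and the first component of \<open>rot_field\<close> are
      nonzero, so each side ranges over all reals: the two spans are the same axis.\<close>
    have "(\<exists>v\<in>coord_space 1. w0 = ?J * v 0) \<longleftrightarrow> (\<exists>a :: nat \<Rightarrow> real. w0 = a 0 * rot_field d q 0)" for w0
    proof -
      have "\<exists>v\<in>coord_space 1. w0 = ?J * v 0"
        by (rule bexI[of _ "vec2 (w0 / ?J) 0"]) (use J(2) in \<open>auto simp: coord_space_iff vec2_def\<close>)
      moreover have "\<exists>a :: nat \<Rightarrow> real. w0 = a 0 * rot_field d q 0"
        by (rule exI[of _ "\<lambda>_. w0 / rot_field d q 0"]) (use rot_field_nonzero in simp)
      ultimately show ?thesis by blast
    qed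
    then have "(\<exists>v\<in>coord_space 1. w0 = ?J * v 0 \<and> w1 = 0) \<longleftrightarrow>
        (\<exists>a :: nat \<Rightarrow> real. w0 = a 0 * rot_field d q 0 \<and> w1 = 0)"
      for w0 w1 :: real by blast
    then show ?thesis
      using J by (simp add: less_2_cases_All X)
  qed
  have "continuous_map (top_of_set (core \<inter> fst c)) (top_of_set moebius) (\<lambda>x. x)"
    using core by (auto simp: continuous_map_in_subtopology)
  then have "smooth_map_on (core_arc c) (points (core_arc c)) moebius_mfd (\<lambda>x. x)"
    unfolding smooth_map_on_def using sm by (simp add: subtopology_subtopology)
  moreover have "connected_space (top_of_set (core \<inter> fst c))"
    using core_arc_connected[OF c] by (simp add: connected_space_subtopology)
  ultimately show ?thesis
    unfolding integral_manifold_def using core_arc_smooth[OF c] core tangent by auto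
qed

text \<open>A point common to both charts lies on both arcs, so that no atlas of the whole circle is
  needed.\<close>

lemma leaf_core:
  assumes "p \<in> core" "p \<in> fst chartA" "p \<in> fst chartB"
  shows "leaf 1 moebius_mfd fold_form (\<lambda>_. sq_dist) (points moebius_mfd) p = core"
proof (intro equalityI subsetI)
  fix q assume "q \<in> leaf 1 moebius_mfd fold_form (\<lambda>_. sq_dist) (points moebius_mfd) p"
  then show "q \<in> core"
    using integral_manifold_in_core assms(1) unfolding leaf_def core_def by blast
next
  fix q assume q: "q \<in> core"
  then obtain c where c: "c \<in> {chartA, chartB}" "q \<in> fst c"
    using chart_covers unfolding core_def by blast
  then have "p \<in> points (core_arc c)" "q \<in> points (core_arc c)"
    using assms q by auto
  then show "q \<in> leaf 1 moebius_mfd fold_form (\<lambda>_. sq_dist) (points moebius_mfd) p"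
    using core_arc_integral_manifold[OF c(1)]
        unfolding leaf_def moebius_mfd_simps topspace_euclidean_subtopology
    by (intro UnionI[of "points (core_arc c)"] CollectI exI[of _ "core_arc c"] conjI refl)
qed

section \<open>Absence of a cotangent model\<close>

text \<open>The line with unit normal \<open>(cos \<theta>, sin \<theta>)\<close> at signed distance \<open>z\<close> from the origin.\<close>

definition strip :: "real \<times> real \<Rightarrow> nat \<Rightarrow> real" where
  "strip = (\<lambda>(\<theta>, z). vec4 ((cos \<theta>)\<^sup>2) (cos \<theta> * sin \<theta>) (z * cos \<theta>) (z * sin \<theta>))"

section \<open>Parametrization by normal angle and signed distance\<close>

lemma continuous_on_strip: "continuous_on S strip"
  unfolding strip_def case_prod_unfold by (intro continuous_intros)

lemma strip_in_moebius: "strip x \<in> moebius"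
proof -
  have "1 - cos \<theta> * cos \<theta> = sin \<theta> * sin \<theta>" for \<theta> :: real
    using sin_squared_eq[of \<theta>] by (simp add: power2_eq_square)
  then show ?thesis
    by (cases x) (simp add: strip_def moebius_def power2_eq_square mult_ac)
qed

lemma sq_dist_strip: "sq_dist (strip (\<theta>, z)) = z\<^sup>2"
  by (simp add: strip_def sq_dist_def power_mult_distrib flip: distrib_left)

lemma strip_in_core_iff: "strip (\<theta>, z) \<in> core \<longleftrightarrow> z = 0"
  by (simp add: core_def strip_in_moebius sq_dist_strip)

text \<open>Reversing the unit normal and the sign of the distance describes the same line. This is
  the gluing of the band along its seam.\<close>

lemma strip_pi: "strip (pi, z) = strip (0, - z)"
  by (simp add: strip_def)

lemma moebius_strip:
  assumes "q \<in> moebius"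
  obtains \<theta> z where "\<theta> \<in> {0..pi}" "q = strip (\<theta>, z)"
proof -
  have q: "(q 1)\<^sup>2 = q 0 * (1 - q 0)" "q 2 * q 1 = q 3 * q 0" "q 2 * (1 - q 0) = q 3 * q 1"
    "vec4 (q 0) (q 1) (q 2) (q 3) = q"
    using assms vec4_collapse[of q] by (auto simp: moebius_def)
  \<comment> \<open>For normal angle \<theta> the two terms are the squares of cos (2 \<theta>) and
    sin (2 \<theta>). Halving the angle of this point of the circle recovers the normal up to
    sign.\<close>
  have "(2 * q 0 - 1)\<^sup>2 + (2 * q 1)\<^sup>2 = 1"
    using q(1) by (simp add: power2_eq_square algebra_simps)
  then obtain t where t: "0 \<le> t" "t < 2 * pi" "2 * q 0 - 1 = cos t" "2 * q 1 = sin t"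
    by (rule sincos_total_2pi)
  define \<theta> where "\<theta> = t / 2"
  have "t = 2 * \<theta>" by (simp add: \<theta>_def)
  then have q01: "q 0 = (cos \<theta>)\<^sup>2" "q 1 = cos \<theta> * sin \<theta>"
    using t(3,4) by (simp_all add: cos_double_cos sin_double)
  \<comment> \<open>Since the normal is a unit vector, \<gamma> = (\<alpha>\<gamma>) \<alpha> +
    (\<beta>\<gamma>) \<beta>.\<close>
  define z where "z = q 2 * cos \<theta> + q 3 * sin \<theta>"
  have "z * cos \<theta> = q 2 * q 0 + q 3 * q 1" "z * sin \<theta> = q 2 * q 1 + q 3 * (1 - q 0)"
    unfolding q01 z_def sin_squared_eq[symmetric] by (simp_all add: algebra_simps power2_eq_square)
  then have "z * cos \<theta> = q 2" "z * sin \<theta> = q 3"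
    using q(2,3) by (simp_all add: algebra_simps)
  then have "q = strip (\<theta>, z)"
    using q(4) q01 by (simp add: strip_def)
  moreover have "\<theta> \<in> {0..pi}"
    using t(1,2) by (simp add: \<theta>_def)
  ultimately show thesis
    by (rule that[rotated])
qed

lemma compact_core: "compact core"
proof -
  have "core = (\<lambda>\<theta>. strip (\<theta>, 0)) ` {0..pi}"
  proof (intro equalityI subsetI)
    fix q assume q: "q \<in> core"
    then obtain \<theta> z where "\<theta> \<in> {0..pi}" "q = strip (\<theta>, z)"
      using moebius_strip unfolding core_def by blast
    with q show "q \<in> (\<lambda>\<theta>. strip (\<theta>, 0)) ` {0..pi}"
      by (auto simp: strip_in_core_iff)
  qed (auto simp: strip_in_core_iff)
  moreover have "continuous_on {0..pi} (\<lambda>\<theta>. strip (\<theta>, 0))"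
    by (rule continuous_on_compose2[OF continuous_on_strip]) (auto intro: continuous_intros)
  ultimately show ?thesis
    using compact_continuous_image compact_Icc by metis
qed

section \<open>Signs of a function vanishing exactly on the core\<close>

lemma connected_same_sign:
  fixes g :: "'a :: topological_space \<Rightarrow> real"
  assumes "connected C" "continuous_on C g" "\<And>x. x \<in> C \<Longrightarrow> g x \<noteq> 0" "a \<in> C" "b \<in> C"
  shows "sgn (g a) = sgn (g b)"
proof -
  have *: "0 < g y" if "0 < g x" "x \<in> C" "y \<in> C" for x y
  proof (rule ccontr)
    assume "\<not> 0 < g y"
    then have "0 \<in> {g y..g x}" using that by auto
    then have "0 \<in> g ` C"
      using connected_contains_Icc[OF connected_continuous_image[OF assms(2,1)], of "g y" "g x"]
        that by auto
    then show False
      using assms(3) by auto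
  qed
  show ?thesis
    using *[of a b] *[of b a] assms(3-5) by (auto simp: sgn_if)
qed

text \<open>The band minus its core is covered by two rectangles, z > 0 and z < 0. Each is
  connected, so \<open>P\<close> has one sign on it, and the seam joins them into a single
  region.\<close>

lemma sign_near_core:
  assumes U: "openin (top_of_set moebius) U" "core \<subseteq> U"
    and P: "continuous_on U P" "\<And>q. q \<in> U \<Longrightarrow> P q = 0 \<longleftrightarrow> q \<in> core"
  shows "\<exists>e s :: real. e > 0 \<and> (\<forall>q\<in>moebius - core. sq_dist q < e\<^sup>2 \<longrightarrow> sgn (P q) = s)"
proof -
  obtain O' where O': "open O'" "U = moebius \<inter> O'"
    using U(1) by (auto simp: openin_open)
  have "open (strip -` O')"
    using O'(1) continuous_on_strip by (rule open_vimage)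
  moreover have "compact ({0..pi} \<times> {0 :: real})"
    by (intro compact_Times) auto
  moreover have "strip (\<theta>, 0) \<in> O'" for \<theta>
    using U(2) O'(2) strip_in_core_iff[of \<theta> 0] by blast
  then have "{0..pi} \<times> {0} \<subseteq> strip -` O'"
    by auto
  \<comment> \<open>Compactness of the segment gives one width for all angles. The endpoint pi is
    included because the seam must lie in the band.\<close>
  ultimately obtain e where e: "e > 0" "(\<Union>x\<in>{0..pi} \<times> {0}. ball x e) \<subseteq> strip -` O'"
    using compact_subset_open_imp_ball_epsilon_subset by blast
  have in_U: "strip (\<theta>, z) \<in> U" if "\<theta> \<in> {0..pi}" "\<bar>z\<bar> < e" for \<theta> z
  proof -
    have "(\<theta>, z) \<in> ball (\<theta>, 0) e"
      using that(2) by (simp add: dist_Pair_Pair dist_real_def)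
    moreover have "(\<theta>, 0) \<in> {0..pi} \<times> {0}"
      using that(1) by simp
    ultimately have "(\<theta>, z) \<in> strip -` O'"
      using e(2) by blast
    then show ?thesis
      using O'(2) strip_in_moebius by blast
  qed
  have sign: "sgn (P (strip (\<theta>, z))) = sgn (P (strip (\<theta>', z')))"
    if I: "connected I" "I \<subseteq> {-e<..<e} - {0}" and mem: "\<theta> \<in> {0..pi}" "\<theta>' \<in> {0..pi}" "z \<in> I" "z' \<in> I"
    for I \<theta> \<theta>' z z'
  proof (rule connected_same_sign[where g = "\<lambda>x. P (strip x)" and C = "{0..pi} \<times> I"])
    show "connected ({0..pi} \<times> I)"
      using I(1) by (intro connected_Times) auto
    show "continuous_on ({0..pi} \<times> I) (\<lambda>x. P (strip x))"
      by (rule continuous_on_compose2[OF P(1) continuous_on_strip]) (use in_U I(2) in force)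
    show "P (strip x) \<noteq> 0" if "x \<in> {0..pi} \<times> I" for x
    proof (cases x)
      case (Pair \<theta> z)
      then have "\<theta> \<in> {0..pi}" "z \<in> {-e<..<e} - {0}"
        using that I(2) by auto
      then have "strip x \<in> U" "strip x \<notin> core"
        using Pair in_U[of \<theta> z] strip_in_core_iff[of \<theta> z] by auto
      then show ?thesis using P(2) by blast
    qed
  qed (use mem in auto)
  define s where "s = sgn (P (strip (0, e / 2)))"
  have pos: "sgn (P (strip (\<theta>, z))) = s" if "\<theta> \<in> {0..pi}" "z \<in> {0<..<e}" for \<theta> z
    unfolding s_def by (rule sign[of "{0<..<e}"]) (use that e(1) in auto)
  have neg: "sgn (P (strip (\<theta>, z))) = s" if "\<theta> \<in> {0..pi}" "z \<in> {-e<..<0}" for \<theta> z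
  proof -
    have "sgn (P (strip (\<theta>, z))) = sgn (P (strip (0, - (e / 2))))"
      by (rule sign[of "{-e<..<0}"]) (use that e(1) in auto)
    \<comment> \<open>Crossing the seam leads from the negative rectangle to the positive
      one.\<close>
    also have "\<dots> = sgn (P (strip (pi, e / 2)))"
      by (simp only: strip_pi)
    also have "\<dots> = s"
      by (rule pos) (use e(1) in auto)
    finally show ?thesis .
  qed
  have "sgn (P q) = s" if q: "q \<in> moebius - core" "sq_dist q < e\<^sup>2" for q
  proof -
    obtain \<theta> z where \<theta>: "\<theta> \<in> {0..pi}" "q = strip (\<theta>, z)"
      using q(1) moebius_strip by blast
    have "z \<noteq> 0" "\<bar>z\<bar> < e"
      using q \<theta>(2) strip_in_core_iff[of \<theta> z] e(1) abs_le_square_iff[of e z]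
      by (auto simp: sq_dist_strip not_less[symmetric])
    then show ?thesis
      using pos[OF \<theta>(1), of z] neg[OF \<theta>(1), of z] \<theta>(2) by (cases "z > 0") auto
  qed
  then show ?thesis
    using e(1) by blast
qed

lemma cotangent_torus_top: "mtop (cotangent_torus n) = top_of_set (torus n \<times> coord_space n)"
  by (simp add: cotangent_torus_def Let_def)

lemma no_cotangent_model_moebius:
  assumes L: "leaf 1 moebius_mfd fold_form F (points moebius_mfd) p = core"
  shows "\<not> admits_folded_cotangent_model 1 moebius_mfd fold_form F p"
proof
  assume "admits_folded_cotangent_model 1 moebius_mfd fold_form F p"
  then obtain U r \<phi> where r: "r > 0" and U: "core \<subseteq> U"
    and diff: "diffeomorphism_on moebius_mfd U (cotangent_torus 1) (torus 1 \<times> momentum_ball 1 r) \<phi>"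
    and \<phi>core: "\<phi> ` core = torus 1 \<times> {\<lambda>_. 0}"
    unfolding admits_folded_cotangent_model_def L by (elim exE conjE) (rule that; assumption)
  define V where "V = torus 1 \<times> momentum_ball 1 r"
  define \<psi> where "\<psi> = inv_into U \<phi>"
  have op: "openin (top_of_set moebius) U" and bij: "bij_betw \<phi> U V"
    and c\<phi>: "continuous_map (subtopology (top_of_set moebius) U)
      (top_of_set (torus 1 \<times> coord_space 1)) \<phi>"
    and c\<psi>: "continuous_map (subtopology (top_of_set (torus 1 \<times> coord_space 1)) V)
      (top_of_set moebius) \<psi>"
    using diff unfolding diffeomorphism_on_def smooth_map_on_def cotangent_torus_top
        moebius_mfd_simps V_def \<psi>_def by auto
  have sub: "U \<subseteq> moebius" "V \<subseteq> torus 1 \<times> coord_space 1"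
    using openin_subset[OF op] by (auto simp: V_def momentum_ball_def)
  have \<phi>: "continuous_on U \<phi>" and \<psi>: "continuous_on V \<psi>"
    using c\<phi> c\<psi> sub
    by (simp_all only: subtopology_subtopology inf_absorb2 continuous_map_in_subtopology
        continuous_map_iff_continuous)
  have V1: "snd v 1 = 0" "snd v i = 0" if "v \<in> V" "i \<ge> 1" for v i
    using that by (auto simp: V_def momentum_ball_def coord_space_iff)
  have \<psi>_in: "\<psi> v \<in> U" "\<phi> (\<psi> v) = v" if "v \<in> V" for v
    using bij that unfolding \<psi>_def bij_betw_def by (auto intro: inv_into_into f_inv_into_f)
  \<comment> \<open>The image of the core is the whole zero section, and \<phi> is injective on
    \<open>U\<close>; hence no other point has momentum 0.\<close>
  have P0: "snd (\<phi> q) 0 = 0 \<longleftrightarrow> q \<in> core" if q: "q \<in> U" for q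
  proof
    assume 0: "snd (\<phi> q) 0 = 0"
    have \<phi>q: "\<phi> q \<in> V" using bij q by (auto simp: bij_betw_def)
    have "snd (\<phi> q) i = 0" for i
      using 0 V1(2)[OF \<phi>q] by (cases "i = 0") auto
    then have "\<phi> q \<in> \<phi> ` core"
      using \<phi>q unfolding \<phi>core by (auto simp: V_def fun_eq_iff)
    then show "q \<in> core"
      using bij U q by (auto simp: bij_betw_def inj_on_def)
  next
    assume "q \<in> core"
    then have "\<phi> q \<in> torus 1 \<times> {\<lambda>_. 0}" using \<phi>core by blast
    then show "snd (\<phi> q) 0 = 0" by auto
  qed
  have "continuous_on U (\<lambda>q. snd (\<phi> q) 0)"
    using continuous_on_compose2[OF continuous_on_coord continuous_on_snd[OF \<phi>]] by auto
  then obtain e s where e: "e > 0" and s: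
      "\<And>q. q \<in> moebius - core \<Longrightarrow> sq_dist q < e\<^sup>2 \<Longrightarrow> sgn (snd (\<phi> q) 0) = s"
    using sign_near_core[OF op U _ P0] by blast
  \<comment> \<open>A segment in the momentum fibre over the torus point 1, crossing the zero
    section at parameter 0 and having momentum \<open>t\<close> at parameter
    \<open>t\<close>.\<close>
  define v :: "real \<Rightarrow> cot_point" where "v t = ((\<lambda>_. 1), vec2 t 0)" for t
  have v: "v t \<in> V" if "\<bar>t\<bar> < r" for t
    using that r by (auto simp: v_def V_def torus_def momentum_ball_def coord_space_iff vec2_def
        abs_less_iff intro!: power2_strict_mono)
  have "continuous_on {-r<..<r} v"
    unfolding v_def by (intro continuous_intros)
  then have "continuous_on {-r<..<r} (\<lambda>t. sq_dist (\<psi> (v t)))"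
    by (intro continuous_on_compose2[OF continuous_on_sq_dist[of UNIV]] continuous_on_compose2[OF
        \<psi>])
      (use v in \<open>auto simp: abs_less_iff\<close>)
  \<comment> \<open>The preimage of the segment passes through the core at 0, so continuity puts it
    into the band of constant sign for small parameters of either sign.\<close>
  then have "isCont (\<lambda>t. sq_dist (\<psi> (v t))) 0"
    using r by (simp add: continuous_on_eq_continuous_at)
  moreover have "sq_dist (\<psi> (v 0)) = 0"
  proof -
    have "\<psi> (v 0) \<in> core"
    proof -
      have "v 0 \<in> V" using v[of 0] r by simp
      then show ?thesis
        using P0[OF \<psi>_in(1)[OF \<open>v 0 \<in> V\<close>]] \<psi>_in(2)[OF \<open>v 0 \<in> V\<close>] by (simp add: v_def)
    qed
    then show ?thesis by (simp add: core_def)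
  qed
  ultimately have "\<forall>\<^sub>F t in at 0. sq_dist (\<psi> (v t)) < e\<^sup>2"
    using e by (simp add: isCont_def order_tendstoD(2))
  then obtain d where d: "d > 0" "\<And>t. t \<noteq> 0 \<Longrightarrow> \<bar>t\<bar> < d \<Longrightarrow> sq_dist (\<psi> (v t)) < e\<^sup>2"
    by (auto simp: eventually_at dist_real_def)
  have const: "sgn t = s" if t: "t \<noteq> 0" "\<bar>t\<bar> < min d r" for t
  proof -
    have "v t \<in> V" using v t(2) by simp
    then have \<psi>v: "\<psi> (v t) \<in> U" "snd (\<phi> (\<psi> (v t))) 0 = t"
      using \<psi>_in by (auto simp: v_def)
    then have "\<psi> (v t) \<in> moebius - core"
      using P0[OF \<psi>v(1)] t(1) sub(1) by auto
    then have "sgn (snd (\<phi> (\<psi> (v t))) 0) = s"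
      by (rule s) (use d(2)[of t] t in auto)
    then show ?thesis
      unfolding \<psi>v(2) .
  qed
  obtain m where m: "0 < m" "m < min d r"
    using dense[of 0 "min d r"] d(1) r by auto
  then have "sgn m = s" "sgn (- m) = s"
    using const[of m] const[of "- m"] by auto
  with m(1) show False
    by simp
qed

theorem proposition18:
  shows "\<exists>n (M :: (nat \<Rightarrow> real) manifold) \<omega> F p.
    folded_symplectic_manifold n M \<omega> \<and>
    folded_integrable_system n M \<omega> F \<and>
    p \<in> folding_hypersurface n M \<omega> \<and>
    regular_point n M \<omega> F p \<and>
    compactin (mtop M) (leaf n M \<omega> F (points M) p) \<and>
    \<not> admits_folded_cotangent_model n M \<omega> F p"
proof (intro exI conjI)
  \<comment> \<open>At angle pi/4 the entry cos^2 is 1/2, neither 0 nor 1, so the point lies in both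
    charts as \<open>leaf_core\<close> requires.\<close>
  let ?p = "strip (pi / 4, 0)"
  have "?p 0 = 1 / 2"
    by (simp add: strip_def cos_45 power_divide)
  then have p: "?p \<in> core" "?p \<in> fst chartA" "?p \<in> fst chartB"
    using strip_in_moebius[of "(pi / 4, 0)"]
        by (simp_all add: strip_in_core_iff chartA_def chartB_def)
  have "core \<subseteq> moebius"
    by (auto simp: core_def)
  show "folded_symplectic_manifold 1 moebius_mfd fold_form"
    by (rule folded_symplectic_moebius)
  show "folded_integrable_system 1 moebius_mfd fold_form (\<lambda>_. sq_dist)"
    by (rule folded_integrable_moebius)
  show "?p \<in> folding_hypersurface 1 moebius_mfd fold_form"
    using p(1) by (simp only: folding_hypersurface_moebius)
  show "regular_point 1 moebius_mfd fold_form (\<lambda>_. sq_dist) ?p"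
    using regular_point_moebius strip_in_moebius by blast
  show "compactin (mtop moebius_mfd) (leaf 1 moebius_mfd fold_form (\<lambda>_. sq_dist) (points
      moebius_mfd) ?p)"
    unfolding leaf_core[OF p] using compact_core \<open>core \<subseteq> moebius\<close>
        by (simp add: compactin_subtopology)
  show "\<not> admits_folded_cotangent_model 1 moebius_mfd fold_form (\<lambda>_. sq_dist) ?p"
    by (rule no_cotangent_model_moebius[OF leaf_core[OF p]])
qed

end
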